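(* The $T^*$-ideal $\mathrm{Id}^*(A)$ is generated, as a $T^*$-ideal, by the following polynomials: 1. $z_1y_1z_2y_2z_3$; 2. $[z_1,z_2]$; 3. $[z_1y_1z_2,y_2]$; 4. $z_1y_1z_2-z_2y_1z_1$; 5. $(-1)^{|x_1x_2|}[x_1,x_2][x_3,x_4]-(-1)^{|x_3x_4|}[x_3,x_4][x_1,x_2]$; 6. $(-1)^{|x_1x_2|}[x_1,x_2][x_3,x_4]-(-1)^{|x_1x_3|}[x_1,x_3][x_2,x_4]+(-1)^{|x_1x_4|}[x_1,x_4][x_2,x_3]$; 7. $[x_1,x_2]z_5[x_3,x_4]$; where in 5, 6 and 7 each $x_i$ ($1\le i\le 4$) is allowed to be either $y_i$ or $z_i$ (all choices are included).
   Context: $K$ is a field of characteristic zero, $e_{i,j}$ are the matrix units of $M_3(K)$, and $A = K(e_{1,1}+e_{3,3})\oplus Ke_{2,2}\oplus Ke_{1,2}\oplus Ke_{2,3}\oplus Ke_{1,3}$, the algebra of matrices $\begin{pmatrix} d&a&c\\0&g&b\\0&0&d\end{pmatrix}$ over $K$. The involution $*$ on $A$ is reflection along the secondary diagonal: $\begin{pmatrix} d&a&c\\0&g&b\\0&0&d\end{pmatrix}^*=\begin{pmatrix} d&b&c\\0&g&a\\0&0&d\end{pmatrix}$. $A^+$ and $A^-$ denote the spaces of symmetric ($u^*=u$) and skew-symmetric ($u^*=-u$) elements. $K\langle Y,Z\rangle$ is the free unital associative algebra with involution on symmetric variables $y_1,y_2,\dots$ ($y_i^*=y_i$) and skew-symmetric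 variables $z_1,z_2,\dots$ ($z_i^*=-z_i$). $\mathrm{Id}^*(A)$ is the set of $*$-identities of $A$, i.e. polynomials in $K\langle Y,Z\rangle$ that vanish whenever the $y_i$ are replaced by elements of $A^+$ and the $z_j$ by elements of $A^-$. A $T^*$-ideal is an ideal invariant under all endomorphisms of $K\langle Y,Z\rangle$ commuting with $*$. $[a,b]=ab-ba$. Put $|x_ix_j|=0$ if the commutator $[x_i,x_j]$ is skew-symmetric (both variables symmetric or both skew-symmetric), and $|x_ix_j|=1$ if $[x_i,x_j]$ is symmetric (one variable symmetric and the other skew-symmetric). *)

theory Defs
  imports "HOL-Analysis.Analysis" "HOL-Library.Poly_Mapping"
begin

section \<open>The free associative algebra with involution\<close>

text \<open>The letters \<open>Sym i\<close> and \<open>Skew i\<close> are the symmetric variable \<open>y\<^sub>i\<close> and the skew-symmetric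
  variable \<open>z\<^sub>i\<close>. The additional index \<open>i = 0\<close> is harmless: there are countably many variables
  of either kind, and nothing depends on their enumeration.\<close>

datatype letter = Sym nat | Skew nat

fun is_skew :: "letter \<Rightarrow> bool" where
  "is_skew (Sym i) = False"
| "is_skew (Skew i) = True"

text \<open>Multiplication of \<open>'m \<Rightarrow>\<^sub>0 'k\<close> is the convolution product for an additively written, not
  necessarily commutative monoid \<open>'m\<close>. Hence the free monoid of words is written additively, and
  finitely supported functions on words form the free unital associative algebra.\<close>

datatype monom_word = Word (letters: "letter list")

instantiation monom_word :: monoid_add
begin

definition zero_monom_word :: monom_word where
  "0 = Word []"

definition plus_monom_word :: "monom_word \<Rightarrow> monom_word \<Rightarrow> monom_word" where
  "u + v = Word (letters u @ letters v)"

instance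
  by standard (simp_all add: zero_monom_word_def plus_monom_word_def)

end

type_synonym 'k free_alg = "monom_word \<Rightarrow>\<^sub>0 'k"

definition gen :: "letter \<Rightarrow> 'k::field free_alg" where
  "gen x = Poly_Mapping.single (Word [x]) 1"

abbreviation yv :: "nat \<Rightarrow> 'k::field free_alg" where "yv i \<equiv> gen (Sym i)"
abbreviation zv :: "nat \<Rightarrow> 'k::field free_alg" where "zv i \<equiv> gen (Skew i)"

definition scalar :: "'k::field \<Rightarrow> 'k free_alg" where
  "scalar c = Poly_Mapping.single 0 c"

definition comm :: "'a::ring \<Rightarrow> 'a \<Rightarrow> 'a" where
  "comm a b = a * b - b * a"

text \<open>The involution reverses a word and multiplies it by \<open>-1\<close> for every skew-symmetric letter.
  The lemmas below show that it is the linear anti-automorphism of order two which fixes each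
  \<open>y\<^sub>i\<close> and negates each \<open>z\<^sub>i\<close>.\<close>

definition word_rev :: "monom_word \<Rightarrow> monom_word" where
  "word_rev w = Word (rev (letters w))"

definition word_sign :: "monom_word \<Rightarrow> 'k::field" where
  "word_sign w = (- 1) ^ length (filter is_skew (letters w))"

definition star :: "'k::field free_alg \<Rightarrow> 'k free_alg" where
  "star p = (\<Sum>w\<in>Poly_Mapping.keys p.
     Poly_Mapping.single (word_rev w) (word_sign w * Poly_Mapping.lookup p w))"

lemma star_zero [simp]: "star 0 = 0"
  by (simp add: star_def)

lemma star_add: "star (p + q) = star p + star q"
  unfolding star_def
  by (rule setsum_keys_plus_distrib) (simp_all add: single_add distrib_left)

lemma star_single:
  "star (Poly_Mapping.single w c) = Poly_Mapping.single (word_rev w) (word_sign w * c)"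
  by (cases "c = 0") (simp_all add: star_def)

lemma star_sum: "star (sum f S) = (\<Sum>x\<in>S. star (f x))"
  by (induction S rule: infinite_finite_induct) (simp_all add: star_add)

lemma word_rev_add: "word_rev (u + v) = word_rev v + word_rev u"
  by (simp add: word_rev_def plus_monom_word_def)

lemma word_sign_add: "word_sign (u + v) = word_sign u * word_sign v"
  by (simp add: word_sign_def plus_monom_word_def power_add)

lemma free_alg_expand:
  "(\<Sum>w\<in>Poly_Mapping.keys p. Poly_Mapping.single w (Poly_Mapping.lookup p w)) = p"
  for p :: "'k::field free_alg"
  by (rule poly_mapping_eqI)
     (auto simp: lookup_sum lookup_single when_def in_keys_iff)

lemma star_mult: "star (p * q) = star q * star p"
proof -
  let ?s = "\<lambda>p w. Poly_Mapping.single w (Poly_Mapping.lookup p w)"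
  let ?K = "Poly_Mapping.keys"
  have m: "star (?s p u * ?s q v) = star (?s q v) * star (?s p u)" for u v
    by (simp add: mult_single star_single word_rev_add word_sign_add mult_ac)
  have "star (p * q) = star ((\<Sum>u\<in>?K p. ?s p u) * (\<Sum>v\<in>?K q. ?s q v))"
    by (simp only: free_alg_expand)
  also have "\<dots> = (\<Sum>u\<in>?K p. \<Sum>v\<in>?K q. star (?s q v) * star (?s p u))"
    by (simp only: sum_product star_sum m)
  also have "\<dots> = star (\<Sum>v\<in>?K q. ?s q v) * star (\<Sum>u\<in>?K p. ?s p u)"
    by (subst sum.swap) (simp only: sum_product star_sum)
  finally show ?thesis
    by (simp only: free_alg_expand)
qed

lemma star_star: "star (star p) = p"
proof -
  have "star (star p) = (\<Sum>w\<in>Poly_Mapping.keys p.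
      Poly_Mapping.single w (word_sign (word_rev w) * (word_sign w * Poly_Mapping.lookup p w)))"
    by (subst star_def) (simp add: star_sum star_single, simp add: word_rev_def)
  also have "\<dots> = p"
    by (subst (2) free_alg_expand [of p, symmetric], rule sum.cong)
       (auto simp: word_sign_def word_rev_def rev_filter [symmetric] mult.assoc [symmetric]
          power_mult_distrib [symmetric])
  finally show ?thesis .
qed

lemma star_gen: "star (yv i) = yv i" "star (zv i) = - zv i"
  by (simp_all add: gen_def star_single word_rev_def word_sign_def single_uminus)

lemma star_scalar: "star (scalar c) = scalar c"
  by (simp add: scalar_def star_single word_rev_def word_sign_def zero_monom_word_def)


section \<open>\<open>T\<^sup>*\<close>-ideals\<close>

definition two_sided_ideal :: "'a::ring_1 set \<Rightarrow> bool" where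
  "two_sided_ideal I \<longleftrightarrow> 0 \<in> I \<and> (\<forall>p\<in>I. \<forall>q\<in>I. p + q \<in> I) \<and>
     (\<forall>p\<in>I. \<forall>r. r * p \<in> I \<and> p * r \<in> I)"

definition star_endomorphism :: "('k::field free_alg \<Rightarrow> 'k free_alg) \<Rightarrow> bool" where
  "star_endomorphism \<phi> \<longleftrightarrow>
     (\<forall>p q. \<phi> (p + q) = \<phi> p + \<phi> q) \<and> (\<forall>p q. \<phi> (p * q) = \<phi> p * \<phi> q) \<and>
     \<phi> 1 = 1 \<and> (\<forall>c p. \<phi> (scalar c * p) = scalar c * \<phi> p) \<and>
     (\<forall>p. \<phi> (star p) = star (\<phi> p))"

definition T_star_ideal :: "'k::field free_alg set \<Rightarrow> bool" where
  "T_star_ideal I \<longleftrightarrow> two_sided_ideal I \<and> (\<forall>\<phi>. star_endomorphism \<phi> \<longrightarrow> \<phi> ` I \<subseteq> I)"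

lemma T_star_ideal_hull: "T_star_ideal (T_star_ideal hull S)"
  by (rule hull_in) (fastforce simp: T_star_ideal_def two_sided_ideal_def)


section \<open>The algebra \<open>A\<close> and its \<open>*\<close>-identities\<close>

definition A_mat :: "'k::field \<Rightarrow> 'k \<Rightarrow> 'k \<Rightarrow> 'k \<Rightarrow> 'k \<Rightarrow> 'k ^ 3 ^ 3" where
  "A_mat d g a b c = vector [vector [d, a, c], vector [0, g, b], vector [0, 0, d]]"

definition A_alg :: "('k::field ^ 3 ^ 3) set" where
  "A_alg = {A_mat d g a b c | d g a b c. True}"

text \<open>The index type \<open>3\<close> has elements \<open>1\<close>, \<open>2\<close>, \<open>3\<close> with arithmetic modulo 3, so \<open>4 - i\<close>
  exchanges \<open>1\<close> and \<open>3\<close> and fixes \<open>2\<close>.\<close>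

definition mat_star :: "'k ^ 3 ^ 3 \<Rightarrow> 'k ^ 3 ^ 3" where
  "mat_star M = (\<chi> i j. M $ (4 - j) $ (4 - i))"

lemma mat_star_A_mat: "mat_star (A_mat d g a b c) = A_mat d g b a c"
  by (simp add: mat_star_def A_mat_def vec_eq_iff forall_3 vector_3)

definition A_plus :: "('k::field ^ 3 ^ 3) set" where
  "A_plus = {u \<in> A_alg. mat_star u = u}"

definition A_minus :: "('k::field ^ 3 ^ 3) set" where
  "A_minus = {u \<in> A_alg. mat_star u = - u}"

text \<open>Evaluation of a polynomial under a substitution of matrices for the letters. The library
  product \<open>*\<close> on \<open>'k ^ 3 ^ 3\<close> is componentwise; the matrix product is \<open>**\<close> with unit \<open>mat 1\<close>.\<close>

definition eval_word :: "(letter \<Rightarrow> 'k::field ^ 3 ^ 3) \<Rightarrow> monom_word \<Rightarrow> 'k ^ 3 ^ 3" where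
  "eval_word \<rho> w = foldr (\<lambda>x M. \<rho> x ** M) (letters w) (mat 1)"

definition eval_poly :: "(letter \<Rightarrow> 'k::field ^ 3 ^ 3) \<Rightarrow> 'k free_alg \<Rightarrow> 'k ^ 3 ^ 3" where
  "eval_poly \<rho> p = (\<Sum>w\<in>Poly_Mapping.keys p.
     map_matrix ((*) (Poly_Mapping.lookup p w)) (eval_word \<rho> w))"

lemma eval_poly_single:
  "eval_poly \<rho> (Poly_Mapping.single w c) = map_matrix ((*) c) (eval_word \<rho> w)"
  by (cases "c = 0") (simp_all add: eval_poly_def map_matrix_def vec_eq_iff)

lemma eval_poly_gen: "eval_poly \<rho> (gen x) = \<rho> x"
  by (simp add: gen_def eval_poly_single eval_word_def map_matrix_def vec_eq_iff)

lemma eval_poly_one: "eval_poly \<rho> 1 = mat 1"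
  by (simp add: single_one [symmetric] eval_poly_single eval_word_def zero_monom_word_def
      map_matrix_def vec_eq_iff del: single_one)

lemma eval_poly_add: "eval_poly \<rho> (p + q) = eval_poly \<rho> p + eval_poly \<rho> q"
  unfolding eval_poly_def
  by (rule setsum_keys_plus_distrib) (simp_all add: map_matrix_def vec_eq_iff distrib_right)

lemma eval_poly_sum: "eval_poly \<rho> (sum f S) = (\<Sum>x\<in>S. eval_poly \<rho> (f x))"
proof -
  have "eval_poly \<rho> 0 = 0"
    by (simp add: eval_poly_def)
  then show ?thesis
    by (induction S rule: infinite_finite_induct) (simp_all add: eval_poly_add)
qed

lemma eval_word_add: "eval_word \<rho> (u + v) = eval_word \<rho> u ** eval_word \<rho> v"
proof -
  have "foldr (\<lambda>x M. \<rho> x ** M) xs N = foldr (\<lambda>x M. \<rho> x ** M) xs (mat 1) ** N" for xs N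
    by (induction xs) (simp_all add: matrix_mul_assoc)
  then show ?thesis
    unfolding eval_word_def plus_monom_word_def monom_word.sel foldr_append by blast
qed

lemma eval_poly_mult: "eval_poly \<rho> (p * q) = eval_poly \<rho> p ** eval_poly \<rho> q"
proof -
  let ?s = "\<lambda>p w. Poly_Mapping.single w (Poly_Mapping.lookup p w)"
  let ?K = "Poly_Mapping.keys"
  have m: "eval_poly \<rho> (?s p u * ?s q v) = eval_poly \<rho> (?s p u) ** eval_poly \<rho> (?s q v)" for u v
    by (simp add: mult_single eval_poly_single eval_word_add map_matrix_def matrix_matrix_mult_def
        vec_eq_iff sum_distrib_left mult_ac)
  have sl: "sum f S ** N = (\<Sum>x\<in>S. f x ** N)"
    and sr: "N ** sum f S = (\<Sum>x\<in>S. N ** f x)"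
    for f :: "monom_word \<Rightarrow> 'a ^ 3 ^ 3" and S N
    by (induction S rule: infinite_finite_induct)
       (simp_all add: matrix_matrix_mult_def vec_eq_iff distrib_left distrib_right sum.distrib)
  have "eval_poly \<rho> (p * q) = eval_poly \<rho> ((\<Sum>u\<in>?K p. ?s p u) * (\<Sum>v\<in>?K q. ?s q v))"
    by (simp only: free_alg_expand)
  also have "\<dots> = eval_poly \<rho> (\<Sum>u\<in>?K p. ?s p u) ** eval_poly \<rho> (\<Sum>v\<in>?K q. ?s q v)"
    by (simp only: sum_product eval_poly_sum m sl sr) (rule sum.swap)
  finally show ?thesis
    by (simp only: free_alg_expand)
qed

definition Id_star_A :: "'k::field free_alg set" where
  "Id_star_A = {p. \<forall>\<rho>. (\<forall>i. \<rho> (Sym i) \<in> A_plus) \<and> (\<forall>j. \<rho> (Skew j) \<in> A_minus) \<longrightarrow>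
     eval_poly \<rho> p = 0}"


section \<open>The generating identities\<close>

definition par :: "letter \<Rightarrow> letter \<Rightarrow> nat" where
  "par u v = (if is_skew u = is_skew v then 0 else 1)"

lemma star_comm_gen:
  "star (comm (gen u) (gen v)) = - ((- 1) ^ par u v) * comm (gen u) (gen v :: 'k::field free_alg)"
proof -
  have minus: "star (- p) = - star p" for p :: "'k free_alg"
    using star_add [of p "- p"] by (simp add: eq_neg_iff_add_eq_0 add.commute)
  have "star (p - q) = star p - star q" for p q :: "'k free_alg"
    using star_add [of p "- q"] by (simp add: minus)
  then show ?thesis
    by (cases u; cases v) (simp_all add: comm_def par_def star_mult star_gen)
qed

text \<open>A family \<open>x\<close> of letters in which each \<open>x i\<close> with \<open>1 \<le> i \<le> 4\<close> is either \<open>y\<^sub>i\<close> or \<open>z\<^sub>i\<close>.\<close>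

definition admissible :: "(nat \<Rightarrow> letter) \<Rightarrow> bool" where
  "admissible x \<longleftrightarrow> (\<forall>i\<in>{1..4}. x i = Sym i \<or> x i = Skew i)"

definition scomm :: "letter \<Rightarrow> letter \<Rightarrow> 'k::field free_alg" where
  "scomm u v = (- 1) ^ par u v * comm (gen u) (gen v)"

definition generators :: "'k::field free_alg set" where
  "generators =
     {zv 1 * yv 1 * zv 2 * yv 2 * zv 3,
      comm (zv 1) (zv 2),
      comm (zv 1 * yv 1 * zv 2) (yv 2),
      zv 1 * yv 1 * zv 2 - zv 2 * yv 1 * zv 1}
   \<union> {scomm (x 1) (x 2) * comm (gen (x 3)) (gen (x 4))
        - scomm (x 3) (x 4) * comm (gen (x 1)) (gen (x 2)) | x. admissible x}
   \<union> {scomm (x 1) (x 2) * comm (gen (x 3)) (gen (x 4))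
        - scomm (x 1) (x 3) * comm (gen (x 2)) (gen (x 4))
        + scomm (x 1) (x 4) * comm (gen (x 2)) (gen (x 3)) | x. admissible x}
   \<union> {comm (gen (x 1)) (gen (x 2)) * zv 5 * comm (gen (x 3)) (gen (x 4)) | x. admissible x}"

end

theory Submission
  imports Defs
begin

text \<open>Let \<open>S\<close> be the ideal of the free algebra generated by the letters \<open>z\<^sub>i\<close> and the commutators
  \<open>[y\<^sub>i, y\<^sub>j]\<close>, and \<open>I\<close> the \<open>T\<^sup>*\<close>-ideal generated by the listed polynomials. On \<open>A\<close> the elements of
  \<open>S\<close> become strictly upper triangular and those of \<open>S\<^sup>2\<close> become multiples of \<open>e\<^sub>1\<^sub>3\<close>; correspondingly
  \<open>S\<^sup>3 \<subseteq> I\<close>, because \<open>I\<close> contains every product with three skew-symmetric factors, whatever stands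
  between them. A direct computation shows that \<open>I\<close> consists of identities of \<open>A\<close>. Conversely, an
  identity of \<open>A\<close> descends through the layers of the chain from the free algebra over \<open>S\<close> and
  \<open>S\<^sup>2\<close> to \<open>I\<close>: because its \<open>(1,1)\<close> entry vanishes on \<open>A\<close> it lies in \<open>S\<close>, because of its \<open>(1,2)\<close>
  entry in \<open>S\<^sup>2\<close>, and because of its \<open>(1,3)\<close> entry in \<open>I\<close> (lemmas \<open>layer1\<close>, \<open>layer2\<close>, \<open>layer3\<close>).

  Each step evaluates a spanning set of one layer at generic matrices with diagonal
  \<open>(d, d - h, d)\<close>. Modulo \<open>S\<close> the free algebra is the polynomial ring in the \<open>y\<^sub>i\<close>, and \<open>y\<^sub>i\<close> has
  value \<open>d\<^sub>i\<close>. Modulo \<open>S\<^sup>2\<close>, the ideal \<open>S\<close> is a module over commuting operators, left multiplication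
  by \<open>y\<^sub>i\<close> and the commutator with \<open>y\<^sub>i\<close>, which act on values as \<open>d\<^sub>i\<close> and \<open>h\<^sub>i\<close>; its generators
  \<open>z\<^sub>i\<close> and \<open>[y\<^sub>i, y\<^sub>j]\<close> have the values \<open>z\<^sub>i\<close> and \<open>h\<^sub>i a\<^sub>j - h\<^sub>j a\<^sub>i\<close>. This is the Koszul differential,
  whose relations are all consequences of \<open>h\<^sub>i D\<^sub>m\<^sub>j - h\<^sub>j D\<^sub>m\<^sub>i = h\<^sub>m D\<^sub>i\<^sub>j\<close> with \<open>D\<^sub>i\<^sub>j = [y\<^sub>i, y\<^sub>j]\<close>, the Jacobi
  identity. Modulo \<open>I\<close>, the ideal \<open>S\<^sup>2\<close> is generated over these operators by the commuting products
  of two such generators, with the Pluecker relation between the \<open>D\<^sub>i\<^sub>j\<close> as the only further relation.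

  That no relation is missing is shown without choosing bases. Every element of the spanning set is
  recovered, modulo the next layer, from its value by one linear map on polynomials: the
  identity on monomials in the \<open>z\<^sub>i\<close>, and the contracting homotopy of the Koszul complex on
  monomials in the \<open>a\<^sub>j\<close>, divided by a positive integer that Euler's formula dictates (lemmas
  \<open>koszul_antisymmetrized\<close> and \<open>koszul2_antisymmetrized\<close>). Since a vanishing polynomial function
  has vanishing coefficients, an element of a layer with value zero lies in the next layer. The
  one hard relation is the Pluecker relation with a factor between the commutators, which is
  needed to let the operators \<open>h\<^sub>i\<close> act on it (lemma \<open>plucker_middle\<close>).\<close>

section \<open>Linear structure and substitutions in the free algebra\<close>

lemma free_alg_induct [case_names zero single add]:
  fixes p :: "'k::field free_alg"
  assumes "P 0" "\<And>w c. P (Poly_Mapping.single w c)" "\<And>p q. P p \<Longrightarrow> P q \<Longrightarrow> P (p + q)"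
  shows "P p"
proof -
  have "P (\<Sum>w\<in>S. Poly_Mapping.single w (Poly_Mapping.lookup p w))" for S
    by (induction S rule: infinite_finite_induct) (auto intro: assms)
  then show ?thesis
    using free_alg_expand [of p] by metis
qed

lemma scalar_commute: "p * scalar c = scalar c * p"
  by (induction p rule: free_alg_induct)
    (simp_all add: scalar_def mult_single mult.commute distrib_left distrib_right)

lemma scalar_simps:
  "scalar (0::'k::field) = 0" "scalar (1::'k) = 1" "scalar (of_nat n :: 'k) = of_nat n"
  "scalar (- a) = - scalar (a::'k)" "scalar (a + b) = scalar a + scalar (b::'k)"
  "scalar (a * b) = scalar a * scalar (b::'k)" "scalar (a - b) = scalar a - scalar (b::'k)"
  by (simp_all add: scalar_def single_add mult_single single_diff single_uminus)

lemma star_minus: "star (- p) = - star p"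
  using star_add [of p "- p"] by (simp add: eq_neg_iff_add_eq_0 add.commute)

lemma star_diff: "star (p - q) = star p - star q"
  using star_add [of p "- q"] by (simp add: star_minus)

lemma star_one: "star 1 = 1"
  using star_scalar [of 1] by (simp add: scalar_simps)

lemma single_letters:
  "Poly_Mapping.single w c = scalar c * prod_list (map gen (letters w))"
proof -
  have "prod_list (map gen xs) = Poly_Mapping.single (Word xs) (1::'a::field)" for xs
    by (induction xs)
      (simp_all add: gen_def mult_single plus_monom_word_def flip: zero_monom_word_def)
  from this [of "letters w"] show ?thesis
    by (simp add: scalar_def mult_single)
qed

definition subst :: "(letter \<Rightarrow> 'k::field free_alg) \<Rightarrow> 'k free_alg \<Rightarrow> 'k free_alg" where
  "subst \<sigma> p = (\<Sum>w\<in>Poly_Mapping.keys p.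
     scalar (Poly_Mapping.lookup p w) * prod_list (map \<sigma> (letters w)))"

lemma subst_single: "subst \<sigma> (Poly_Mapping.single w c) = scalar c * prod_list (map \<sigma> (letters w))"
  by (cases "c = 0") (simp_all add: subst_def scalar_simps)

lemma subst_add: "subst \<sigma> (p + q) = subst \<sigma> p + subst \<sigma> q"
  unfolding subst_def
  by (rule setsum_keys_plus_distrib) (simp_all add: scalar_simps distrib_right)

lemma subst_zero: "subst \<sigma> 0 = 0"
  by (simp add: subst_def)

lemma subst_mult: "subst \<sigma> (p * q) = subst \<sigma> p * subst \<sigma> q"
proof (induction p rule: free_alg_induct)
  case (single u c)
  show ?case
  proof (induction q rule: free_alg_induct)
    case (single v d)
    have "scalar (c * d) * (P * Q) = scalar c * P * (scalar d * Q)" for P Q :: "'a free_alg"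
      by (metis mult.assoc scalar_commute scalar_simps(6))
    then show ?case
      by (simp add: mult_single subst_single plus_monom_word_def)
  qed (simp_all add: subst_zero subst_add distrib_left)
qed (simp_all add: subst_zero subst_add distrib_right)

lemma subst_scalar: "subst \<sigma> (scalar c) = scalar c"
  by (simp add: scalar_def subst_single zero_monom_word_def mult_single)

lemma subst_one: "subst \<sigma> 1 = 1"
  using subst_scalar [of \<sigma> 1] by (simp add: scalar_simps)

lemma subst_minus: "subst \<sigma> (- p) = - subst \<sigma> p"
  using subst_add [of \<sigma> p "- p"] by (simp add: subst_zero eq_neg_iff_add_eq_0 add.commute)

lemma subst_diff: "subst \<sigma> (p - q) = subst \<sigma> p - subst \<sigma> q"
  using subst_add [of \<sigma> p "- q"] by (simp add: subst_minus)

lemma subst_gen: "subst \<sigma> (gen x) = \<sigma> x"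
  by (simp add: gen_def subst_single scalar_simps)

lemma subst_letters: "subst \<sigma> (prod_list (map gen xs)) = prod_list (map \<sigma> xs)"
  by (induction xs) (simp_all add: subst_one subst_mult subst_gen)

text \<open>The free algebra is free on symmetric and skew-symmetric elements: both sides of
  \<open>\<phi> (star p) = star (\<phi> p)\<close> are linear and anti-multiplicative in \<open>p\<close>, so it
  suffices that they agree on letters.\<close>

lemma star_endomorphism_subst:
  assumes "\<And>i. star (\<sigma> (Sym i)) = \<sigma> (Sym i)" "\<And>i. star (\<sigma> (Skew i)) = - \<sigma> (Skew i)"
  shows "star_endomorphism (subst \<sigma>)"
proof -
  have "subst \<sigma> (star (gen x)) = star (\<sigma> x)" for x
    by (cases x) (simp_all add: assms star_gen subst_minus subst_gen)
  then have "subst \<sigma> (star (prod_list (map gen xs))) = star (prod_list (map \<sigma> xs))" for xs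
    by (induction xs) (simp_all add: star_one subst_one star_mult subst_mult)
  then have "subst \<sigma> (star (Poly_Mapping.single w c)) = star (subst \<sigma> (Poly_Mapping.single w c))"
    for w c
    by (simp add: single_letters star_mult star_scalar subst_mult subst_scalar subst_letters)
  then have "subst \<sigma> (star p) = star (subst \<sigma> p)" for p
    by (induction p rule: free_alg_induct) (simp_all add: subst_zero subst_add star_add)
  then show ?thesis
    by (simp add: star_endomorphism_def subst_add subst_mult subst_one subst_scalar)
qed

lemma star_endomorphism_gen:
  assumes "star_endomorphism \<phi>"
  shows "\<phi> = subst (\<lambda>x. \<phi> (gen x))"
proof
  fix p
  have add: "\<phi> (p + q) = \<phi> p + \<phi> q" and mult: "\<phi> (p * q) = \<phi> p * \<phi> q" and one: "\<phi> 1 = 1"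
    and sc: "\<phi> (scalar c * p) = scalar c * \<phi> p" for p q c
    using assms by (auto simp: star_endomorphism_def)
  have "\<phi> (prod_list (map gen xs)) = prod_list (map (\<lambda>x. \<phi> (gen x)) xs)" for xs
    by (induction xs) (simp_all add: one mult)
  then show "\<phi> p = subst (\<lambda>x. \<phi> (gen x)) p"
    using add [of 0 0]
    by (induction p rule: free_alg_induct)
      (simp_all add: subst_zero subst_add add subst_single single_letters sc subst_mult
        subst_scalar subst_letters)
qed

section \<open>The identities of \<open>A\<close> form a \<open>T\<^sup>*\<close>-ideal\<close>

lemma A_mat_mult:
  "A_mat d g a b c ** A_mat d' g' a' b' c' =
     A_mat (d * d') (g * g') (d * a' + a * g') (g * b' + b * d') (d * c' + a * b' + c * d')"
  by (simp add: A_mat_def matrix_matrix_mult_def vec_eq_iff forall_3 vector_3 sum_3)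

lemma A_mat_arith:
  "A_mat d g a b c + A_mat d' g' a' b' c' = A_mat (d + d') (g + g') (a + a') (b + b') (c + c')"
  "A_mat d g a b c - A_mat d' g' a' b' c' = A_mat (d - d') (g - g') (a - a') (b - b') (c - c')"
  "- A_mat d g a b c = A_mat (- d) (- g) (- a) (- b) (- c)"
  "map_matrix ((*) s) (A_mat d g a b c) = A_mat (s * d) (s * g) (s * a) (s * b) (s * c)"
  "(0 :: 'k::field ^ 3 ^ 3) = A_mat 0 0 0 0 0" "(mat 1 :: 'k::field ^ 3 ^ 3) = A_mat 1 1 0 0 0"
  by (simp_all add: A_mat_def map_matrix_def mat_def vec_eq_iff forall_3 vector_3)

lemma A_mat_eq_iff:
  "A_mat d g a b c = A_mat d' g' a' b' c' \<longleftrightarrow> d = d' \<and> g = g' \<and> a = a' \<and> b = b' \<and> c = c'"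
  unfolding A_mat_def vec_eq_iff forall_3 vector_3 by blast

lemma A_mat_in_A_alg: "A_mat d g a b c \<in> A_alg"
  unfolding A_alg_def by blast

lemma A_alg_closed:
  assumes "M \<in> A_alg"
  shows "N \<in> A_alg \<Longrightarrow> M + N \<in> A_alg" "N \<in> A_alg \<Longrightarrow> M ** N \<in> A_alg"
    "map_matrix ((*) s) M \<in> A_alg"
proof -
  obtain d g a b c where M: "M = A_mat d g a b c"
    using assms unfolding A_alg_def by blast
  show "map_matrix ((*) s) M \<in> A_alg"
    by (simp add: M A_mat_arith(4) A_mat_in_A_alg)
  assume "N \<in> A_alg"
  then obtain d' g' a' b' c' where N: "N = A_mat d' g' a' b' c'"
    unfolding A_alg_def by blast
  show "M + N \<in> A_alg" "M ** N \<in> A_alg"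
    by (simp_all add: M N A_mat_arith(1) A_mat_mult A_mat_in_A_alg)
qed

lemma A_plus_eq: "(A_plus :: ('k::field ^ 3 ^ 3) set) = {A_mat d g a a c | d g a c. True}"
proof
  show "A_plus \<subseteq> {A_mat d g a a c | (d :: 'k) g a c. True}"
  proof
    fix u :: "'k ^ 3 ^ 3" assume "u \<in> A_plus"
    then obtain d g a b c where u: "u = A_mat d g a b c" and "mat_star u = u"
      unfolding A_plus_def A_alg_def by blast
    then have "A_mat d g b a c = A_mat d g a b c"
      by (metis mat_star_A_mat)
    then have "a = b"
      unfolding A_mat_eq_iff by blast
    with u show "u \<in> {A_mat d g a a c | (d :: 'k) g a c. True}"
      by blast
  qed
  show "{A_mat d g a a c | (d :: 'k) g a c. True} \<subseteq> A_plus"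
    unfolding A_plus_def A_alg_def using mat_star_A_mat by blast
qed

lemma A_minus_eq: "(A_minus :: ('k::field_char_0 ^ 3 ^ 3) set) = {A_mat 0 0 a (- a) 0 | a. True}"
proof
  have char: "x = - x \<longleftrightarrow> x = 0" for x :: 'k
    by (simp only: eq_neg_iff_add_eq_0 mult_2 [symmetric]) simp
  show "A_minus \<subseteq> {A_mat 0 0 a (- a) 0 | a :: 'k. True}"
  proof
    fix u :: "'k ^ 3 ^ 3" assume "u \<in> A_minus"
    then obtain d g a b c where u: "u = A_mat d g a b c" and "mat_star u = - u"
      unfolding A_minus_def A_alg_def by blast
    then have "A_mat d g b a c = A_mat (- d) (- g) (- a) (- b) (- c)"
      by (metis mat_star_A_mat A_mat_arith(3))
    then have "d = 0" "g = 0" "b = - a" "c = 0"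
      unfolding A_mat_eq_iff char by blast+
    with u show "u \<in> {A_mat 0 0 a (- a) 0 | a. True}"
      by blast
  qed
  show "{A_mat 0 0 a (- a) 0 | a :: 'k. True} \<subseteq> A_minus"
  proof
    fix u :: "'k ^ 3 ^ 3" assume "u \<in> {A_mat 0 0 a (- a) 0 | a :: 'k. True}"
    then obtain a where u: "u = A_mat 0 0 a (- a) 0"
      by blast
    have "mat_star u = - u"
      by (simp add: u mat_star_A_mat A_mat_arith(3))
    with u show "u \<in> A_minus"
      unfolding A_minus_def A_alg_def by blast
  qed
qed

lemma eval_poly_zero: "eval_poly \<rho> 0 = 0"
  by (simp add: eval_poly_def)

lemma eval_poly_minus: "eval_poly \<rho> (- p) = - eval_poly \<rho> p"
  using eval_poly_add [of \<rho> p "- p"] by (simp add: eval_poly_zero eq_neg_iff_add_eq_0 add.commute)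

lemma eval_poly_diff: "eval_poly \<rho> (p - q) = eval_poly \<rho> p - eval_poly \<rho> q"
  using eval_poly_add [of \<rho> p "- q"] by (simp add: eval_poly_minus)

lemma eval_poly_scalar: "eval_poly \<rho> (scalar c * p) = map_matrix ((*) c) (eval_poly \<rho> p)"
proof -
  have "map_matrix ((*) c) (mat 1) ** M = map_matrix ((*) c) M" for M :: "'a ^ 3 ^ 3"
    by (simp add: map_matrix_def matrix_matrix_mult_def mat_def vec_eq_iff forall_3 sum_3)
  then show ?thesis
    by (simp add: eval_poly_mult scalar_def eval_poly_single eval_word_def zero_monom_word_def)
qed

definition star_assignment :: "(letter \<Rightarrow> 'k::field ^ 3 ^ 3) \<Rightarrow> bool" where
  "star_assignment \<rho> \<longleftrightarrow> (\<forall>i. \<rho> (Sym i) \<in> A_plus) \<and> (\<forall>j. \<rho> (Skew j) \<in> A_minus)"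

lemma eval_poly_in_A_alg:
  assumes "star_assignment \<rho>"
  shows "eval_poly \<rho> p \<in> A_alg"
proof -
  have gen: "\<rho> x \<in> A_alg" for x
    using assms by (cases x) (auto simp: star_assignment_def A_plus_def A_minus_def)
  have "eval_poly \<rho> (prod_list (map gen xs)) \<in> A_alg" for xs
    by (induction xs)
      (simp_all add: A_mat_arith(6) eval_poly_one eval_poly_mult eval_poly_gen gen A_alg_closed
        A_mat_in_A_alg)
  then have "eval_poly \<rho> (Poly_Mapping.single w c) \<in> A_alg" for w c
    by (simp add: single_letters eval_poly_scalar A_alg_closed)
  then show ?thesis
    by (induction p rule: free_alg_induct)
      (simp_all add: A_mat_arith(5) eval_poly_zero eval_poly_add A_alg_closed A_mat_in_A_alg)
qed

lemma mat_star_mult: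
  assumes "M \<in> A_alg" "N \<in> A_alg"
  shows "mat_star (M ** N) = mat_star N ** mat_star M"
  using assms by (auto simp: A_alg_def A_mat_mult mat_star_A_mat A_mat_eq_iff algebra_simps)

lemma mat_star_linear:
  "mat_star (M + N) = mat_star M + mat_star N" "mat_star 0 = 0" "mat_star (- M) = - mat_star M"
  "mat_star (map_matrix ((*) c) M) = map_matrix ((*) c) (mat_star M)"
  by (simp_all add: mat_star_def vec_eq_iff map_matrix_def)

lemma eval_poly_star:
  assumes "star_assignment \<rho>"
  shows "eval_poly \<rho> (star p) = mat_star (eval_poly \<rho> p)"
proof -
  have gen: "eval_poly \<rho> (star (gen x)) = mat_star (\<rho> x)" for x
    using assms
    by (cases x) (auto simp: star_assignment_def A_plus_def A_minus_def star_gen eval_poly_minus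
        eval_poly_gen)
  have "eval_poly \<rho> (star (prod_list (map gen xs))) = mat_star (eval_poly \<rho> (prod_list (map gen xs)))"
    for xs
  proof (induction xs)
    case (Cons x xs)
    have "mat_star (\<rho> x ** eval_poly \<rho> (prod_list (map gen xs)))
        = mat_star (eval_poly \<rho> (prod_list (map gen xs))) ** mat_star (\<rho> x)"
      using eval_poly_in_A_alg [OF assms, of "gen x"]
      by (intro mat_star_mult eval_poly_in_A_alg [OF assms]) (simp add: eval_poly_gen)
    then show ?case
      by (simp add: star_mult eval_poly_mult gen Cons eval_poly_gen)
  qed (simp add: star_one eval_poly_one A_mat_arith mat_star_A_mat)
  then have "eval_poly \<rho> (star (Poly_Mapping.single w c))
      = mat_star (eval_poly \<rho> (Poly_Mapping.single w c))" for w c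
    unfolding single_letters star_mult star_scalar scalar_commute eval_poly_scalar mat_star_linear
    by simp
  then show ?thesis
    by (induction p rule: free_alg_induct)
      (simp_all add: star_add eval_poly_zero eval_poly_add mat_star_linear)
qed

lemma eval_poly_subst: "eval_poly \<rho> (subst \<sigma> p) = eval_poly (\<lambda>x. eval_poly \<rho> (\<sigma> x)) p"
proof -
  have "eval_poly \<rho> (prod_list (map \<sigma> xs))
      = eval_poly (\<lambda>x. eval_poly \<rho> (\<sigma> x)) (prod_list (map gen xs))" for xs
    by (induction xs) (simp_all add: eval_poly_one eval_poly_mult eval_poly_gen)
  then have "eval_poly \<rho> (subst \<sigma> (Poly_Mapping.single w c))
      = eval_poly (\<lambda>x. eval_poly \<rho> (\<sigma> x)) (Poly_Mapping.single w c)" for w c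
    by (simp add: single_letters subst_mult subst_scalar subst_letters eval_poly_scalar)
  then show ?thesis
    by (induction p rule: free_alg_induct) (simp_all add: subst_zero subst_add eval_poly_zero eval_poly_add)
qed

lemma Id_star_A_iff: "p \<in> Id_star_A \<longleftrightarrow> (\<forall>\<rho>. star_assignment \<rho> \<longrightarrow> eval_poly \<rho> p = 0)"
  by (simp add: Id_star_A_def star_assignment_def)

lemma T_star_ideal_Id_star_A: "T_star_ideal (Id_star_A :: 'k::field free_alg set)"
  unfolding T_star_ideal_def two_sided_ideal_def
proof (intro conjI allI impI ballI image_subsetI)
  fix \<phi> :: "'k free_alg \<Rightarrow> 'k free_alg" and p :: "'k free_alg"
  assume \<phi>: "star_endomorphism \<phi>" and p: "p \<in> Id_star_A"
  show "\<phi> p \<in> Id_star_A"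
    unfolding Id_star_A_iff
  proof (intro allI impI)
    fix \<rho> :: "letter \<Rightarrow> 'k ^ 3 ^ 3" assume \<rho>: "star_assignment \<rho>"
    have comm: "\<phi> (star p) = star (\<phi> p)" for p
      using \<phi> by (simp add: star_endomorphism_def)
    have minus: "\<phi> (- q) = - \<phi> q" for q
      by (metis \<phi> star_endomorphism_gen subst_minus)
    have "star (\<phi> (yv i)) = \<phi> (yv i)" "star (\<phi> (zv i)) = - \<phi> (zv i)" for i
      by (metis comm minus star_gen)+
    then have "mat_star (eval_poly \<rho> (\<phi> (yv i))) = eval_poly \<rho> (\<phi> (yv i))"
      "mat_star (eval_poly \<rho> (\<phi> (zv i))) = - eval_poly \<rho> (\<phi> (zv i))" for i
      by (metis eval_poly_star [OF \<rho>] eval_poly_minus)+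
    then have "star_assignment (\<lambda>x. eval_poly \<rho> (\<phi> (gen x)))"
      by (simp add: star_assignment_def A_plus_def A_minus_def eval_poly_in_A_alg [OF \<rho>])
    then show "eval_poly \<rho> (\<phi> p) = 0"
      using p by (subst star_endomorphism_gen [OF \<phi>]) (simp add: eval_poly_subst Id_star_A_iff)
  qed
qed (auto simp: Id_star_A_iff eval_poly_zero eval_poly_add eval_poly_mult)

lemma generators_subset_Id_star_A: "(generators :: 'k::field_char_0 free_alg set) \<subseteq> Id_star_A"
proof
  fix p :: "'k free_alg" assume p: "p \<in> generators"
  show "p \<in> Id_star_A"
    unfolding Id_star_A_iff
  proof (intro allI impI)
    fix \<rho> :: "letter \<Rightarrow> 'k ^ 3 ^ 3" assume \<rho>: "star_assignment \<rho>"
    then have "\<forall>i. \<exists>d g a c. \<rho> (Sym i) = A_mat d g a a c" "\<forall>i. \<exists>a. \<rho> (Skew i) = A_mat 0 0 a (- a) 0"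
      by (auto simp: star_assignment_def A_plus_eq A_minus_eq)
    then obtain d g a c z where y: "\<rho> (Sym i) = A_mat (d i) (g i) (a i) (a i) (c i)"
      and z: "\<rho> (Skew i) = A_mat 0 0 (z i) (- z i) 0" for i
      by metis
    define h :: "letter \<Rightarrow> 'k" where "h = case_letter (\<lambda>i. d i - g i) (\<lambda>_. 0)"
    define \<alpha> :: "letter \<Rightarrow> 'k" where "\<alpha> = case_letter a z"
    define D where "D u v = h u * \<alpha> v - h v * \<alpha> u" for u v
    (* Every commutator of letters is strictly upper triangular, its (1,2) entry is the minor D u v,
       and its (2,3) entry is the same minor up to the sign that records its symmetry. So the two
       signed families express that the minors commute and satisfy the Pluecker relation. *)
    have "\<exists>e. eval_poly \<rho> (comm (gen u) (gen v)) = A_mat 0 0 (D u v) (- ((- 1) ^ par u v) * D u v) e"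
      for u v
      by (cases u; cases v)
        (simp_all add: comm_def eval_poly_diff eval_poly_mult eval_poly_gen y z A_mat_mult A_mat_arith
          A_mat_eq_iff D_def h_def \<alpha>_def par_def algebra_simps)
    then obtain e where comm: "eval_poly \<rho> (comm (gen u) (gen v))
        = A_mat 0 0 (D u v) (- ((- 1) ^ par u v) * D u v) (e u v)" for u v
      by metis
    have sgn: "(- 1) ^ par u v = (scalar ((- 1) ^ par u v) :: 'k free_alg)" for u v
      by (simp add: par_def scalar_simps)
    have prod: "eval_poly \<rho> (scomm u v * comm (gen u') (gen v'))
        = A_mat 0 0 0 0 (- ((- 1) ^ par u v * (- 1) ^ par u' v' * D u v * D u' v'))" for u v u' v'
      unfolding scomm_def sgn eval_poly_mult [of \<rho> "_ * _"] eval_poly_scalar comm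
      by (simp add: A_mat_mult A_mat_arith A_mat_eq_iff)
    have D0: "D u v = 0" if "is_skew u" "is_skew v" for u v
      using that by (cases u; cases v) (simp_all add: D_def h_def)
    consider "p = zv 1 * yv 1 * zv 2 * yv 2 * zv 3" | "p = comm (zv 1) (zv 2)"
      | "p = comm (zv 1 * yv 1 * zv 2) (yv 2)" | "p = zv 1 * yv 1 * zv 2 - zv 2 * yv 1 * zv 1"
      | x :: "nat \<Rightarrow> letter" where "p = scomm (x 1) (x 2) * comm (gen (x 3)) (gen (x 4))
          - scomm (x 3) (x 4) * comm (gen (x 1)) (gen (x 2))"
      | x :: "nat \<Rightarrow> letter" where "p = scomm (x 1) (x 2) * comm (gen (x 3)) (gen (x 4))
          - scomm (x 1) (x 3) * comm (gen (x 2)) (gen (x 4))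
          + scomm (x 1) (x 4) * comm (gen (x 2)) (gen (x 3))"
      | x :: "nat \<Rightarrow> letter" where "p = comm (gen (x 1)) (gen (x 2)) * zv 5 * comm (gen (x 3)) (gen (x 4))"
      using p unfolding generators_def by blast
    then show "eval_poly \<rho> p = 0"
    proof cases
      case (6 x)
      have plucker: "D a b * D a' b' + D a b' * D b a' = D a a' * D b b'" for a b a' b'
        by (simp add: D_def algebra_simps)
      show ?thesis
        unfolding 6 eval_poly_add eval_poly_diff prod
        using D0 [of "x 1" "x 2"] D0 [of "x 1" "x 3"] D0 [of "x 1" "x 4"] D0 [of "x 2" "x 3"]
          D0 [of "x 2" "x 4"] D0 [of "x 3" "x 4"] plucker [of "x 1" "x 2" "x 3" "x 4"]
        by (cases "is_skew (x 1)"; cases "is_skew (x 2)"; cases "is_skew (x 3)"; cases "is_skew (x 4)")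
          (simp_all add: A_mat_arith A_mat_eq_iff par_def algebra_simps neg_eq_iff_add_eq_0)
    next
      case (5 x)
      show ?thesis
        unfolding 5 eval_poly_diff prod by (simp add: A_mat_arith)
    next
      case 1
      then show ?thesis
        by (simp add: eval_poly_mult eval_poly_gen y z A_mat_mult A_mat_arith A_mat_eq_iff)
    next
      case 2
      show ?thesis
        unfolding 2 comm_def
        by (simp add: eval_poly_diff eval_poly_mult eval_poly_gen z A_mat_mult A_mat_arith A_mat_eq_iff)
    next
      case 3
      show ?thesis
        unfolding 3 comm_def eval_poly_diff eval_poly_mult eval_poly_gen y z A_mat_mult A_mat_arith
          A_mat_eq_iff
        by simp
    next
      case 4
      show ?thesis
        unfolding 4 eval_poly_diff eval_poly_mult eval_poly_gen y z A_mat_mult A_mat_arith A_mat_eq_iff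
        by simp
    next
      case (7 x)
      then show ?thesis
        by (simp add: eval_poly_mult eval_poly_gen z comm A_mat_mult A_mat_arith A_mat_eq_iff)
    qed
  qed
qed

section \<open>Congruences modulo two-sided ideals\<close>

definition cong_mod :: "'a::ring_1 set \<Rightarrow> 'a \<Rightarrow> 'a \<Rightarrow> bool" where
  "cong_mod J x y \<longleftrightarrow> x - y \<in> J"

text \<open>These two rules spare calculations the higher-order unification that substitution by an equation
  would need.\<close>

lemma cong_mod_eq_trans [trans]:
  "x = y \<Longrightarrow> cong_mod J y z \<Longrightarrow> cong_mod J x z"
  "cong_mod J x y \<Longrightarrow> y = z \<Longrightarrow> cong_mod J x z"
  by simp_all

locale ring_ideal =
  fixes J :: "'a::ring_1 set"
  assumes ideal: "two_sided_ideal J"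
begin

lemma zero: "0 \<in> J"
  using ideal by (simp add: two_sided_ideal_def)

lemma add: "x \<in> J \<Longrightarrow> y \<in> J \<Longrightarrow> x + y \<in> J"
  using ideal by (simp add: two_sided_ideal_def)

lemma mult_left: "x \<in> J \<Longrightarrow> r * x \<in> J"
  using ideal by (simp add: two_sided_ideal_def)

lemma mult_right: "x \<in> J \<Longrightarrow> x * r \<in> J"
  using ideal by (simp add: two_sided_ideal_def)

lemma minus: "x \<in> J \<Longrightarrow> - x \<in> J"
  using mult_left [of x "- 1"] by simp

lemma diff: "x \<in> J \<Longrightarrow> y \<in> J \<Longrightarrow> x - y \<in> J"
  using add [OF _ minus, of x y] by simp

lemma comm: "x \<in> J \<Longrightarrow> Defs.comm r x \<in> J"
  by (simp add: comm_def diff mult_left mult_right)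

lemma cong_refl: "cong_mod J x x"
  by (simp add: cong_mod_def zero)

lemma cong_sym: "cong_mod J x y \<Longrightarrow> cong_mod J y x"
  unfolding cong_mod_def by (metis minus minus_diff_eq)

lemma cong_trans [trans]: "cong_mod J x y \<Longrightarrow> cong_mod J y z \<Longrightarrow> cong_mod J x z"
  unfolding cong_mod_def by (metis add diff_add_cancel diff_add_eq add_diff_eq)

lemma cong_add: "cong_mod J x y \<Longrightarrow> cong_mod J x' y' \<Longrightarrow> cong_mod J (x + x') (y + y')"
  unfolding cong_mod_def by (metis add add_diff_add)

lemma cong_minus: "cong_mod J x y \<Longrightarrow> cong_mod J (- x) (- y)"
  unfolding cong_mod_def by (metis minus minus_diff_commute minus_diff_eq diff_minus_eq_add add.commute
      uminus_add_conv_diff)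

lemma cong_diff: "cong_mod J x y \<Longrightarrow> cong_mod J x' y' \<Longrightarrow> cong_mod J (x - x') (y - y')"
  using cong_add [OF _ cong_minus, of x y x' y'] by simp

lemma cong_mult_left: "cong_mod J x y \<Longrightarrow> cong_mod J (r * x) (r * y)"
  unfolding cong_mod_def by (metis mult_left right_diff_distrib)

lemma cong_mult_right: "cong_mod J x y \<Longrightarrow> cong_mod J (x * r) (y * r)"
  unfolding cong_mod_def by (metis mult_right left_diff_distrib)

lemma cong_comm: "cong_mod J x y \<Longrightarrow> cong_mod J (Defs.comm r x) (Defs.comm r y)"
  unfolding comm_def by (intro cong_diff cong_mult_left cong_mult_right)

lemma cong_sum_mset:
  "(\<And>m. m \<in># B \<Longrightarrow> cong_mod J (f m) (g m)) \<Longrightarrow>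
     cong_mod J (\<Sum>m\<in>#B. f m) (\<Sum>m\<in>#B. g m)"
  by (induction B) (simp_all add: cong_refl cong_add)

end

lemma sum_mset_subtractf:
  "(\<Sum>m\<in>#B. f m - g m) = (\<Sum>m\<in>#B. f m) - (\<Sum>m\<in>#B. g m :: 'a::ab_group_add)"
  by (induction B) simp_all

section \<open>Consequences of the generating identities\<close>

abbreviation (input) gen_ideal :: "'k::field_char_0 free_alg set" where
  "gen_ideal \<equiv> T_star_ideal hull generators"

abbreviation gen_cong (infix "\<simeq>" 50) where
  "x \<simeq> y \<equiv> cong_mod gen_ideal x y"

interpretation I: ring_ideal "gen_ideal :: 'k::field_char_0 free_alg set"
proof
  show "two_sided_ideal (gen_ideal :: 'k free_alg set)"
    using T_star_ideal_hull [of "generators :: 'k free_alg set"] by (simp add: T_star_ideal_def)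
qed

abbreviation symmetric :: "'k::field free_alg \<Rightarrow> bool" where "symmetric p \<equiv> star p = p"
abbreviation skew :: "'k::field free_alg \<Rightarrow> bool" where "skew p \<equiv> star p = - p"

text \<open>All consequences of the generating polynomials are read off by substituting arbitrary symmetric
  and skew-symmetric elements for the letters.\<close>

lemma subst_generator:
  assumes "p \<in> generators" "\<And>i. symmetric (\<sigma> (Sym i))" "\<And>i. skew (\<sigma> (Skew i))"
  shows "subst \<sigma> p \<in> gen_ideal"
  using T_star_ideal_hull [of generators] star_endomorphism_subst [of \<sigma>] assms
    hull_inc [of p generators]
  unfolding T_star_ideal_def by blast

lemma skew_comm: "symmetric a \<Longrightarrow> symmetric b \<Longrightarrow> skew (comm a b)"
  by (simp add: comm_def star_diff star_mult)

lemma gen_skew3: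
  fixes p q r :: "'k::field_char_0 free_alg"
  assumes "skew p" "skew q" "skew r" "symmetric u" "symmetric v"
  shows "p * u * q * v * r \<in> gen_ideal"
  using assms subst_generator [of "zv 1 * yv 1 * zv 2 * yv 2 * zv 3"
      "case_letter (\<lambda>i. if i = 1 then u else v) (\<lambda>i. if i = 1 then p else if i = 2 then q else r)"]
  by (simp add: generators_def subst_mult subst_gen)

lemma gen_skew2_central:
  fixes p q :: "'k::field_char_0 free_alg"
  assumes "skew p" "skew q" "symmetric u" "symmetric v"
  shows "comm (p * u * q) v \<in> gen_ideal"
  using assms subst_generator [of "comm (zv 1 * yv 1 * zv 2) (yv 2)"
      "case_letter (\<lambda>i. if i = 1 then u else v) (\<lambda>i. if i = 1 then p else q)"]
  by (simp add: generators_def comm_def subst_diff subst_mult subst_gen)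

lemma gen_skew2_symmetric:
  fixes p q :: "'k::field_char_0 free_alg"
  assumes "skew p" "skew q" "symmetric u"
  shows "p * u * q - q * u * p \<in> gen_ideal"
  using assms subst_generator [of "zv 1 * yv 1 * zv 2 - zv 2 * yv 1 * zv 1"
      "case_letter (\<lambda>_. u) (\<lambda>i. if i = 1 then p else q)"]
  by (simp add: generators_def subst_diff subst_mult subst_gen)

lemma scalar_half:
  fixes x :: "'k::field_char_0 free_alg"
  shows "scalar (1 / 2) * (2 * x) = x"
proof -
  have two: "(2 :: 'k free_alg) = scalar 2"
    using scalar_simps(3) [of 2, where ?'k = 'k] by simp
  show ?thesis
    by (simp only: two mult.assoc [symmetric] scalar_simps(6) [symmetric]) (simp add: scalar_simps)
qed

lemma symmetric_skew_decomposition: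
  fixes x :: "'k::field_char_0 free_alg"
  obtains s k where "symmetric s" "skew k" "x = s + k"
proof
  let ?h = "scalar (1 / 2) :: 'k free_alg"
  show "symmetric (?h * (x + star x))" "skew (?h * (x - star x))"
    by (simp_all add: star_mult star_scalar star_add star_diff star_star scalar_commute algebra_simps)
  show "x = ?h * (x + star x) + ?h * (x - star x)"
    using scalar_half [of x]
    by (simp add: mult_2 flip: distrib_left)
qed

text \<open>Splitting a factor into its symmetric and its skew-symmetric part removes the symmetry
  assumptions on the factors between skew-symmetric elements: a skew-symmetric factor there
  would be a third skew-symmetric one, and such products vanish.\<close>

lemma skew3:
  fixes p q r :: "'k::field_char_0 free_alg"
  assumes "skew p" "skew q" "skew r"
  shows "p * u * q * v * r \<in> gen_ideal"
proof -
  have one: "a * b * c \<in> gen_ideal" if "skew a" "skew b" "skew c" for a b c :: "'k free_alg"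
    using gen_skew3 [OF that, of 1 1] by (simp add: star_one)
  obtain s k where u: "symmetric s" "skew k" "u = s + k"
    by (rule symmetric_skew_decomposition)
  obtain s' k' where v: "symmetric s'" "skew k'" "v = s' + k'"
    by (rule symmetric_skew_decomposition)
  have "p * u * q * v * r = p * s * q * s' * r + p * s * (q * k' * r) + (p * k * q) * (v * r)"
    by (simp add: u v algebra_simps)
  then show ?thesis
    using gen_skew3 [OF assms u(1) v(1)] one [of q k' r] one [of p k q] assms u(2) v(2)
    by (simp add: I.add I.mult_left I.mult_right)
qed

lemma skew3_adjacent:
  fixes p q r :: "'k::field_char_0 free_alg"
  assumes "skew p" "skew q" "skew r"
  shows "p * q * r \<in> gen_ideal"
  using skew3 [OF assms, of 1 1] by simp

lemma skew2_symmetric: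
  fixes p q :: "'k::field_char_0 free_alg"
  assumes "skew p" "skew q"
  shows "p * u * q \<simeq> q * u * p"
proof -
  obtain s k where u: "symmetric s" "skew k" "u = s + k"
    by (rule symmetric_skew_decomposition)
  have "p * u * q - q * u * p = (p * s * q - q * s * p) + (p * k * q - q * k * p)"
    by (simp add: u algebra_simps)
  then show ?thesis
    unfolding cong_mod_def
    using gen_skew2_symmetric [OF assms u(1)] skew3_adjacent [OF assms(1) u(2) assms(2)]
      skew3_adjacent [OF assms(2) u(2) assms(1)]
    by (simp only: I.add I.diff)
qed

lemma skew2_central:
  fixes p q :: "'k::field_char_0 free_alg"
  assumes "skew p" "skew q"
  shows "p * u * q * v \<simeq> v * (p * u * q)"
proof -
  obtain s k where u: "symmetric s" "skew k" "u = s + k"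
    by (rule symmetric_skew_decomposition)
  obtain s' k' where v: "symmetric s'" "skew k'" "v = s' + k'"
    by (rule symmetric_skew_decomposition)
  have "p * u * q * v - v * (p * u * q)
      = comm (p * s * q) s' + (p * s * q * 1 * k' - k' * 1 * p * s * q) + comm (p * k * q) v"
    by (simp add: u v comm_def algebra_simps)
  moreover have "comm (p * k * q) v \<in> gen_ideal"
    using skew3_adjacent [OF assms(1) u(2) assms(2)]
    by (simp add: comm_def I.diff I.mult_left I.mult_right)
  ultimately show ?thesis
    unfolding cong_mod_def
    using gen_skew2_central [OF assms u(1) v(1)] assms v(2)
    by (simp only: I.add I.diff skew3)
qed

section \<open>The Pluecker relation with a factor in the middle\<close>

lemma plucker:
  fixes a b c d :: "'k::field_char_0 free_alg"
  assumes "symmetric a" "symmetric b" "symmetric c" "symmetric d"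
  shows "comm a b * comm c d - comm a c * comm b d + comm a d * comm b c \<in> gen_ideal"
proof -
  define \<sigma> where "\<sigma> = case_letter (\<lambda>i. if i = 1 then a else if i = 2 then b else
    if i = 3 then c else d) (\<lambda>_. 0)"
  have adm: "admissible Sym"
    by (simp add: admissible_def)
  have "scomm (Sym 1) (Sym 2) * comm (gen (Sym 3)) (gen (Sym 4))
      - scomm (Sym 1) (Sym 3) * comm (gen (Sym 2)) (gen (Sym 4))
      + scomm (Sym 1) (Sym 4) * comm (gen (Sym 2)) (gen (Sym 3)) \<in> (generators :: 'k free_alg set)"
    unfolding generators_def using adm by blast
  from subst_generator [OF this, of \<sigma>] assms show ?thesis
    by (simp add: scomm_def par_def comm_def subst_add subst_diff subst_mult subst_gen \<sigma>_def)
qed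

text \<open>The generating relation has nothing between the two commutators. Let \<open>Q e a b c d\<close> be what
  arises when the first commutator of each term is replaced by its commutator with a symmetric \<open>e\<close>.
  Substituting \<open>a e + e a\<close> for \<open>a\<close> in the relation shows that \<open>Q\<close> is antisymmetric in \<open>e\<close> and \<open>a\<close>
  modulo the ideal, whereas the Jacobi identity, together with the exchange of the two commutators,
  shows that it is symmetric in them. Hence \<open>2 Q\<close> lies in the ideal, and \<open>Q\<close> is the relation
  multiplied by \<open>e\<close> from the left minus the relation with \<open>e\<close> in the middle. A
  skew-symmetric factor in the middle gives products of three skew-symmetric elements.\<close>

lemma plucker_middle:
  fixes a b c d :: "'k::field_char_0 free_alg"
  assumes sym: "symmetric a" "symmetric b" "symmetric c" "symmetric d"
  shows "comm a b * u * comm c d - comm a c * u * comm b d + comm a d * u * comm b c \<in> gen_ideal"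
proof -
  define P where "P a b c d = comm a b * comm c d - comm a c * comm b d + comm a d * comm b c"
    for a b c d :: "'k free_alg"
  define M where "M x a b c d = comm a b * x * comm c d - comm a c * x * comm b d
    + comm a d * x * comm b c" for x a b c d :: "'k free_alg"
  have "M e a b c d \<in> gen_ideal" if e: "symmetric e" for e
  proof -
    define T where "T x a b c d = comm x (comm a b) * comm c d" for x a b c d :: "'k free_alg"
    define Q where "Q x a b c d = T x a b c d - T x a c b d + T x a d b c"
      for x a b c d :: "'k free_alg"
    have MQ: "M x a b c d = x * P a b c d - Q x a b c d" for x a b c d
      by (simp add: M_def P_def Q_def T_def comm_def algebra_simps)
    have ae: "symmetric (a * e + e * a)"
      using sym e by (simp add: star_add star_mult add.commute)
    have P: "P a b c d \<in> gen_ideal" "P e b c d \<in> gen_ideal" "P (a * e + e * a) b c d \<in> gen_ideal"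
      unfolding P_def by (rule plucker; rule sym e ae)+
    have "P (a * e + e * a) b c d = a * P e b c d + e * P a b c d + M a e b c d + M e a b c d"
      by (simp add: P_def M_def comm_def algebra_simps)
    then have "Q e a b c d + Q a e b c d
        = 2 * (a * P e b c d + e * P a b c d) - P (a * e + e * a) b c d"
      by (simp add: MQ mult_2 algebra_simps)
    also have "\<dots> \<in> gen_ideal"
      using P by (simp add: I.add I.diff I.mult_left)
    finally have anti: "Q e a b c d + Q a e b c d \<in> gen_ideal" .
    have jacobi: "T a x b c d = T x a b c d + T b x a c d" for x a b c d
      by (simp add: T_def comm_def algebra_simps)
    have swap: "T x a b c d - T x c d a b \<in> gen_ideal"
      if "symmetric a" "symmetric b" "symmetric c" "symmetric d" for x a b c d
    proof -
      have "T x a b c d - T x c d a b = x * (comm a b * 1 * comm c d - comm c d * 1 * comm a b)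
          - (comm a b * x * comm c d - comm c d * x * comm a b)"
        by (simp add: T_def comm_def [of x] algebra_simps)
      then show ?thesis
        using skew2_symmetric [OF skew_comm [OF that(1,2)] skew_comm [OF that(3,4)]]
        unfolding cong_mod_def by (simp only: I.diff I.mult_left)
    qed
    have "Q e a b c d - Q a e b c d
        = - (T b e a c d - T b c d e a) + (T c e a b d - T c b d e a) - (T d e a b c - T d b c e a)"
      by (simp add: Q_def jacobi [of a e b c d] jacobi [of a e c b d] jacobi [of a e d b c]
          jacobi [of c b d e a])
    also have "\<dots> \<in> gen_ideal"
      using sym e by (intro I.add I.diff I.minus swap)
    finally have "Q e a b c d - Q a e b c d \<in> gen_ideal" .
    from I.add [OF anti this] have "2 * Q e a b c d \<in> gen_ideal"
      by (simp add: mult_2)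
    then have "Q e a b c d \<in> gen_ideal"
      using I.mult_left [of "2 * Q e a b c d" "scalar (1 / 2)"] by (simp add: scalar_half)
    then show ?thesis
      using P by (simp add: MQ I.diff I.mult_left)
  qed
  moreover obtain s k where u: "symmetric s" "skew k" "u = s + k"
    by (rule symmetric_skew_decomposition)
  moreover have "M k a b c d \<in> gen_ideal"
    unfolding M_def using sym u(2) by (intro I.add I.diff skew3_adjacent skew_comm)
  ultimately have "M s a b c d + M k a b c d \<in> gen_ideal"
    by (intro I.add) simp_all
  then show ?thesis
    by (simp add: u M_def algebra_simps)
qed

section \<open>The ideal generated by the basic skew-symmetric elements\<close>

abbreviation ycomm :: "nat \<Rightarrow> nat \<Rightarrow> 'k::field free_alg" where
  "ycomm i j \<equiv> comm (yv i) (yv j)"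

definition basic_skew :: "'k::field free_alg set" where
  "basic_skew = range zv \<union> {ycomm i j | i j. True}"

lemma skew_basic_skew: "s \<in> basic_skew \<Longrightarrow> skew s"
  by (auto simp: basic_skew_def star_gen skew_comm)

text \<open>Evaluated on \<open>A\<close>, the elements of this ideal become strictly upper triangular, and those of its
  square become multiples of \<open>e\<^sub>1\<^sub>3\<close>.\<close>

inductive_set skew_ideal :: "'k::field free_alg set" where
  zero: "0 \<in> skew_ideal"
| base: "s \<in> basic_skew \<Longrightarrow> u * s * v \<in> skew_ideal"
| add: "x \<in> skew_ideal \<Longrightarrow> y \<in> skew_ideal \<Longrightarrow> x + y \<in> skew_ideal"

inductive_set skew_ideal2 :: "'k::field free_alg set" where
  zero: "0 \<in> skew_ideal2"
| mult: "x \<in> skew_ideal \<Longrightarrow> y \<in> skew_ideal \<Longrightarrow> x * y \<in> skew_ideal2"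
| add: "x \<in> skew_ideal2 \<Longrightarrow> y \<in> skew_ideal2 \<Longrightarrow> x + y \<in> skew_ideal2"

interpretation S: ring_ideal "skew_ideal :: 'k::field free_alg set"
proof
  have "r * p \<in> skew_ideal \<and> p * r \<in> skew_ideal" if "p \<in> skew_ideal" for r p :: "'k free_alg"
    using that
  proof induction
    case (base s u v)
    then show ?case
      using skew_ideal.base [of s "r * u" v] skew_ideal.base [of s u "v * r"]
      by (simp add: mult.assoc)
  qed (simp_all add: skew_ideal.intros distrib_left distrib_right)
  then show "two_sided_ideal (skew_ideal :: 'k free_alg set)"
    by (simp add: two_sided_ideal_def skew_ideal.intros)
qed

interpretation S2: ring_ideal "skew_ideal2 :: 'k::field free_alg set"
proof
  have "r * p \<in> skew_ideal2 \<and> p * r \<in> skew_ideal2" if "p \<in> skew_ideal2" for r p :: "'k free_alg"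
    using that
  proof induction
    case (mult x y)
    then show ?case
      using skew_ideal2.mult [of "r * x" y] skew_ideal2.mult [of x "y * r"]
      by (simp add: mult.assoc S.mult_left S.mult_right)
  qed (simp_all add: skew_ideal2.intros distrib_left distrib_right)
  then show "two_sided_ideal (skew_ideal2 :: 'k free_alg set)"
    by (simp add: two_sided_ideal_def skew_ideal2.intros)
qed

lemma basic_skew_in_skew_ideal: "s \<in> basic_skew \<Longrightarrow> s \<in> skew_ideal"
  using skew_ideal.base [of s 1 1] by simp

lemma zv_basic: "zv i \<in> basic_skew" and ycomm_basic: "ycomm i j \<in> basic_skew"
  unfolding basic_skew_def by blast+

lemma zv_in_skew_ideal: "zv i \<in> skew_ideal" and ycomm_in_skew_ideal: "ycomm i j \<in> skew_ideal"
  by (simp_all add: basic_skew_in_skew_ideal zv_basic ycomm_basic)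

lemma free_alg_gen_induct [case_names one gen scalar add]:
  fixes p :: "'k::field free_alg"
  assumes "P 1" "\<And>x p. P p \<Longrightarrow> P (gen x * p)" "\<And>c p. P p \<Longrightarrow> P (scalar c * p)"
    "\<And>p q. P p \<Longrightarrow> P q \<Longrightarrow> P (p + q)"
  shows "P p"
proof -
  have "P (prod_list (map gen xs))" for xs
    by (induction xs) (simp_all add: assms)
  then have single: "P (Poly_Mapping.single w c)" for w c
    by (simp add: single_letters assms)
  from assms(3) [OF assms(1), of 0] have "P 0"
    by (simp add: scalar_simps)
  then show ?thesis
    by (induction p rule: free_alg_induct) (simp_all add: single assms)
qed

text \<open>The letters commute modulo \<open>skew_ideal\<close>, hence so does everything.\<close>

lemma comm_in_skew_ideal: "comm p q \<in> skew_ideal"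
proof -
  have letters: "comm (gen x) (gen y) \<in> skew_ideal" for x y :: letter
    by (cases x; cases y)
      (auto simp: ycomm_in_skew_ideal comm_def [of "gen (Sym _)" "gen (Skew _)"]
        comm_def [of "gen (Skew _)"] S.diff S.mult_left S.mult_right zv_in_skew_ideal)
  have "comm (gen x) q \<in> skew_ideal" for x
  proof (induction q rule: free_alg_gen_induct)
    case (gen y q)
    have "comm (gen x) (gen y * q) = comm (gen x) (gen y) * q + gen y * comm (gen x) q"
      by (simp add: comm_def algebra_simps)
    then show ?case
      by (simp add: letters gen.IH S.add S.mult_left S.mult_right)
  next
    case (scalar c q)
    have "comm (gen x) (scalar c * q) = scalar c * comm (gen x) q"
      by (simp add: comm_def algebra_simps) (metis mult.assoc scalar_commute)
    then show ?case
      by (simp add: scalar.IH S.mult_left)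
  next
    case (add p q)
    then show ?case
      using S.add [OF add] by (simp add: comm_def algebra_simps)
  qed (simp add: comm_def S.zero)
  note left = this
  show ?thesis
  proof (induction p rule: free_alg_gen_induct)
    case (gen y p)
    have "comm (gen y * p) q = gen y * comm p q + comm (gen y) q * p"
      by (simp add: comm_def algebra_simps)
    then show ?case
      by (simp add: left gen.IH S.add S.mult_left S.mult_right)
  next
    case (scalar c p)
    have "comm (scalar c * p) q = scalar c * comm p q"
      by (simp add: comm_def algebra_simps) (metis mult.assoc scalar_commute)
    then show ?case
      by (simp add: scalar.IH S.mult_left)
  next
    case (add p p')
    then show ?case
      using S.add [OF add] by (simp add: comm_def algebra_simps)
  qed (simp add: comm_def S.zero)
qed

text \<open>This is why commutators with different \<open>y\<^sub>i\<close> act on \<open>skew_ideal\<close> as commuting operators modulo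
  its square: by the Jacobi identity their commutator is the one with \<open>[y\<^sub>i, y\<^sub>j]\<close>.\<close>

lemma skew_ideal2_comm: "x \<in> skew_ideal \<Longrightarrow> comm (comm p q) x \<in> skew_ideal2"
  by (simp add: comm_def [of "comm p q"] S2.diff skew_ideal2.mult comm_in_skew_ideal)

lemma skew_ideal_cube:
  fixes x y w :: "'k::field_char_0 free_alg"
  assumes "x \<in> skew_ideal" "y \<in> skew_ideal" "w \<in> skew_ideal"
  shows "x * y * w \<in> gen_ideal"
  using assms(1)
proof induction
  case (base s u v)
  note s = base
  show ?case
    using assms(2)
  proof induction
    case (base t u' v')
    note t = base
    show ?case
      using assms(3)
    proof induction
      case (base r u'' v'')
      have "u * s * v * (u' * t * v') * (u'' * r * v'')
          = u * (s * (v * u') * t * (v' * u'') * r) * v''"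
        by (simp add: mult.assoc)
      then show ?case
        using s t base by (simp add: skew3 skew_basic_skew I.mult_left I.mult_right)
    qed (simp_all add: I.zero I.add distrib_left)
  qed (simp_all add: I.zero I.add distrib_left distrib_right)
qed (simp_all add: I.zero I.add distrib_right)

lemma skew_ideal2_mult:
  assumes "x \<in> skew_ideal2" "y \<in> skew_ideal"
  shows "x * y \<in> (gen_ideal :: 'k::field_char_0 free_alg set)" "y * x \<in> gen_ideal"
  using assms(1) by (induction)
    (simp_all add: I.zero I.add distrib_left distrib_right skew_ideal_cube assms(2)
      flip: mult.assoc)

lemma cong2_mult_right:
  assumes "cong_mod skew_ideal2 x y" "w \<in> skew_ideal"
  shows "x * w \<simeq> y * (w :: 'k::field_char_0 free_alg)"
  using skew_ideal2_mult(1) [OF assms [unfolded cong_mod_def]]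
  by (simp add: cong_mod_def left_diff_distrib)

text \<open>For basic \<open>s\<close> and \<open>t\<close> the product \<open>s w t\<close> is central modulo the ideal. In \<open>u s w t w'\<close> it can be
  moved out of the way, and interchanging the remaining factors with \<open>v\<close> costs their commutator,
  which is a third factor from \<open>skew_ideal\<close>.\<close>

lemma skew_ideal_prod_central:
  fixes x y v :: "'k::field_char_0 free_alg"
  assumes "x \<in> skew_ideal" "y \<in> skew_ideal"
  shows "x * y * v \<simeq> v * (x * y)"
  using assms(1)
proof induction
  case (base s u w)
  note s = base
  show ?case
    using assms(2)
  proof induction
    case (base t u' w')
    define c where "c = s * (w * u') * t"
    have c: "c * p \<simeq> p * c" for p
      unfolding c_def using s base by (intro skew2_central skew_basic_skew)
    have "c \<in> skew_ideal2"
      unfolding c_def using s base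
      by (simp add: skew_ideal2.mult S.mult_right basic_skew_in_skew_ideal)
    then have diff: "comm (u * w') v * c \<in> gen_ideal"
      by (simp add: skew_ideal2_mult comm_in_skew_ideal)
    have "u * s * w * (u' * t * w') * v = u * (c * (w' * v))"
      by (simp add: c_def mult.assoc)
    also have "\<dots> \<simeq> u * (w' * v * c)"
      by (intro I.cong_mult_left c)
    also have "\<dots> \<simeq> v * u * (w' * c)"
      using diff by (simp add: cong_mod_def comm_def algebra_simps)
    also have "\<dots> \<simeq> v * u * (c * w')"
      by (intro I.cong_mult_left I.cong_sym [OF c])
    also have "\<dots> = v * (u * s * w * (u' * t * w'))"
      by (simp add: c_def mult.assoc)
    finally show ?case .
  qed (simp_all add: I.cong_refl distrib_left distrib_right I.cong_add)
qed (simp_all add: I.cong_refl distrib_left distrib_right I.cong_add)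

section \<open>Commuting operators\<close>

definition yprod :: "nat list \<Rightarrow> 'k::field free_alg" where
  "yprod U = prod_list (map yv U)"

definition ad :: "nat list \<Rightarrow> 'k::field free_alg \<Rightarrow> 'k free_alg" where
  "ad L x = foldr (\<lambda>i. comm (yv i)) L x"

lemma ad_simps [simp]: "ad [] x = x" "ad (i # L) x = comm (yv i) (ad L x)"
  and ad_append: "ad (L @ L') x = ad L (ad L' x)"
  by (simp_all add: ad_def)

lemma ad_in_skew_ideal: "x \<in> skew_ideal \<Longrightarrow> ad L x \<in> skew_ideal"
  by (induction L) (simp_all add: S.comm)

lemma comm_diff: "comm r (x - y) = comm r x - comm r (y :: 'a::ring)"
  by (simp add: comm_def algebra_simps)

lemma ad_diff: "ad L (x - y) = ad L x - ad L y"
  by (induction L) (simp_all add: comm_diff)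

lemma ad_comm:
  assumes "x \<in> skew_ideal"
  shows "cong_mod skew_ideal2 (ad L (comm (yv i) x)) (comm (yv i) (ad L x))"
proof (induction L)
  case (Cons j L)
  have "comm (yv j) (comm (yv i) (ad L x)) - comm (yv i) (comm (yv j) (ad L x))
      = comm (ycomm j i) (ad L x)"
    by (simp add: comm_def algebra_simps)
  then have "cong_mod skew_ideal2 (comm (yv j) (comm (yv i) (ad L x)))
      (comm (yv i) (comm (yv j) (ad L x)))"
    by (simp add: cong_mod_def skew_ideal2_comm ad_in_skew_ideal assms)
  with S2.cong_comm [OF Cons] show ?case
    by (auto intro: S2.cong_trans)
qed (simp add: S2.cong_refl)

lemma ad_permute:
  assumes "x \<in> skew_ideal" "mset L = mset L'"
  shows "cong_mod skew_ideal2 (ad L x) (ad L' x)"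
  using assms(2)
proof (induction L arbitrary: L')
  case (Cons i L)
  then obtain P Q where L': "L' = P @ i # Q"
    by (metis list.set_intros(1) mset_eq_setD split_list)
  then have "mset L = mset (P @ Q)"
    using Cons.prems by simp
  then have "cong_mod skew_ideal2 (comm (yv i) (ad L x)) (comm (yv i) (ad (P @ Q) x))"
    by (intro S2.cong_comm Cons.IH)
  also have "cong_mod skew_ideal2 \<dots> (ad P (comm (yv i) (ad Q x)))"
    unfolding ad_append by (rule S2.cong_sym [OF ad_comm [OF ad_in_skew_ideal [OF assms(1)]]])
  finally show ?case
    by (simp add: L' ad_append)
qed (simp add: S2.cong_refl)

lemma yprod_permute:
  assumes "mset U = mset U'"
  shows "cong_mod skew_ideal (yprod U) (yprod U' :: 'k::field free_alg)"
  using assms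
proof (induction U arbitrary: U')
  case (Cons i U)
  then obtain P Q where U': "U' = P @ i # Q"
    by (metis list.set_intros(1) mset_eq_setD split_list)
  then have "mset U = mset (P @ Q)"
    using Cons.prems by simp
  then have "cong_mod skew_ideal (yv i * yprod U) (yv i * (yprod (P @ Q) :: 'k free_alg))"
    by (intro S.cong_mult_left Cons.IH)
  also have "cong_mod skew_ideal \<dots> (yprod P * yv i * yprod Q)"
    using S.mult_right [OF comm_in_skew_ideal [of "yv i" "yprod P"], of "yprod Q"]
    by (simp add: cong_mod_def comm_def yprod_def algebra_simps)
  finally show ?case
    by (simp add: U' yprod_def mult.assoc)
qed (simp add: S.cong_refl)

text \<open>By the two previous lemmas the order of the factors does not matter modulo \<open>skew_ideal\<close>, and the
  order of the commutators does not matter modulo \<open>skew_ideal2\<close>. Sorting picks representatives that depend only on the multiset of indices.\<close>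

definition ymonom :: "nat multiset \<Rightarrow> 'k::field free_alg" where
  "ymonom A = yprod (sorted_list_of_multiset A)"

definition ad_mset :: "nat multiset \<Rightarrow> 'k::field free_alg \<Rightarrow> 'k free_alg" where
  "ad_mset B = ad (sorted_list_of_multiset B)"

lemma yprod_ymonom: "cong_mod skew_ideal (yprod U) (ymonom (mset U))"
  unfolding ymonom_def by (intro yprod_permute) simp

lemma ad_ad_mset: "x \<in> skew_ideal \<Longrightarrow> cong_mod skew_ideal2 (ad L x) (ad_mset (mset L) x)"
  unfolding ad_mset_def by (intro ad_permute) simp_all

lemma ad_mset_in_skew_ideal: "x \<in> skew_ideal \<Longrightarrow> ad_mset B x \<in> skew_ideal"
  by (simp add: ad_mset_def ad_in_skew_ideal)

lemma ad_mset_diff: "ad_mset B (x - y) = ad_mset B x - ad_mset B y"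
  by (simp add: ad_mset_def ad_diff)

lemma ad_mset_add_mset:
  assumes "x \<in> skew_ideal"
  shows "cong_mod skew_ideal2 (ad_mset (add_mset i B) x) (comm (yv i) (ad_mset B x))"
    and "cong_mod skew_ideal2 (ad_mset (add_mset i B) x) (ad_mset B (comm (yv i) x))"
proof -
  show "cong_mod skew_ideal2 (ad_mset (add_mset i B) x) (comm (yv i) (ad_mset B x))"
    using ad_permute [OF assms, of "sorted_list_of_multiset (add_mset i B)"
        "i # sorted_list_of_multiset B"]
    by (simp add: ad_mset_def)
  also have "cong_mod skew_ideal2 \<dots> (ad_mset B (comm (yv i) x))"
    unfolding ad_mset_def by (rule S2.cong_sym [OF ad_comm [OF assms]])
  finally show "cong_mod skew_ideal2 (ad_mset (add_mset i B) x) (ad_mset B (comm (yv i) x))" .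
qed

text \<open>The left-hand side unfolds to a signed sum of products \<open>p s q t\<close>. In each of them \<open>s\<close> and \<open>t\<close> may
  be interchanged across \<open>q\<close>, which gives the right-hand side. The factor \<open>u\<close> is there for
  the induction, in which a letter moves from the left of the first factor to its right.\<close>

lemma ad_exchange:
  fixes s t :: "'k::field_char_0 free_alg"
  assumes "s \<in> basic_skew" "t \<in> basic_skew"
  shows "ad L s * u * t \<simeq> ad L t * u * s"
proof (induction L arbitrary: u)
  case (Cons i L)
  have "ad (i # L) s * u * t = yv i * (ad L s * u * t) - ad L s * (yv i * u) * t"
    by (simp add: comm_def algebra_simps)
  also have "\<dots> \<simeq> yv i * (ad L t * u * s) - ad L t * (yv i * u) * s"
    by (intro I.cong_diff I.cong_mult_left Cons.IH)
  also have "\<dots> = ad (i # L) t * u * s"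
    by (simp add: comm_def algebra_simps)
  finally show ?case .
qed (simp add: skew2_symmetric skew_basic_skew assms)

lemma ad_mset_exchange:
  fixes s t :: "'k::field_char_0 free_alg"
  assumes "s \<in> basic_skew" "t \<in> basic_skew"
  shows "ad_mset B s * t \<simeq> ad_mset B t * s"
  using ad_exchange [OF assms, of _ 1] by (simp add: ad_mset_def)

lemma ad_plucker:
  "ad L (ycomm a b) * u * ycomm c d - ad L (ycomm a c) * u * ycomm b d
     + ad L (ycomm a d) * u * ycomm b c \<in> (gen_ideal :: 'k::field_char_0 free_alg set)"
proof (induction L arbitrary: u)
  case Nil
  show ?case
    using plucker_middle [of "yv a" "yv b" "yv c" "yv d" u] by (simp add: star_gen)
next
  case (Cons i L)
  let ?R = "\<lambda>L u. ad L (ycomm a b) * u * ycomm c d - ad L (ycomm a c) * u * ycomm b d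
     + ad L (ycomm a d) * u * ycomm b c :: 'k free_alg"
  have "?R (i # L) u = yv i * ?R L u - ?R L (yv i * u)"
    by (simp add: comm_def [of _ "ad L _"] algebra_simps)
  then show ?case
    using Cons.IH by (simp add: I.diff I.mult_left)
qed

lemma ad_mset_plucker:
  "ad_mset B (ycomm m j) * ycomm i l - ad_mset B (ycomm m i) * ycomm j l
     \<simeq> ad_mset B (ycomm m l) * (ycomm i j :: 'k::field_char_0 free_alg)"
proof -
  let ?x = "\<lambda>b c d. ad (sorted_list_of_multiset B) (ycomm m b) * (1 :: 'k free_alg) * ycomm c d"
  have "?x j i l - ?x i j l - ?x l i j = - (?x i j l - ?x j i l + ?x l i j)"
    by (simp add: algebra_simps)
  then show ?thesis
    unfolding cong_mod_def ad_mset_def using I.minus [OF ad_plucker [of _ m i 1 j l]] by simp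
qed

section \<open>Sections of the Koszul differential\<close>

text \<open>Read \<open>ad_mset B\<close> as multiplication by the monomial \<open>h\<^sup>B\<close> and \<open>ycomm m j\<close> as the basis element
  \<open>D\<^sub>m\<^sub>j\<close> of the exterior square, which the Koszul differential sends to \<open>h\<^sub>m a\<^sub>j - h\<^sub>j a\<^sub>m\<close>.
  Then \<open>koszul B j\<close> is the image of \<open>h\<^sup>B a\<^sub>j\<close> under the contracting homotopy, the sum of the
  \<open>(\<partial>h\<^sup>B / \<partial>h\<^sub>m) D\<^sub>m\<^sub>j\<close>. Likewise \<open>koszul2 B j k\<close> is the image of \<open>h\<^sup>B a\<^sub>j a\<^sub>k\<close> under the second-order
  analogue, which differentiates twice and multiplies by \<open>D\<^sub>m\<^sub>j D\<^sub>n\<^sub>k\<close>.\<close>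

definition koszul :: "nat multiset \<Rightarrow> nat \<Rightarrow> 'k::field free_alg" where
  "koszul B j = (\<Sum>m\<in>#B. ad_mset (B - {#m#}) (ycomm m j))"

definition koszul2 :: "nat multiset \<Rightarrow> nat \<Rightarrow> nat \<Rightarrow> 'k::field free_alg" where
  "koszul2 B j k = (\<Sum>n\<in>#B. koszul (B - {#n#}) j * ycomm n k)"

lemma sum_mset_remove1_add_mset:
  fixes F :: "'a \<Rightarrow> 'a multiset \<Rightarrow> 'b::comm_monoid_add"
  shows "(\<Sum>m\<in>#add_mset i B. F m (add_mset i B - {#m#}))
     = F i B + (\<Sum>m\<in>#B. F m (add_mset i (B - {#m#})))"
proof -
  have "image_mset (\<lambda>m. F m (add_mset i B - {#m#})) B
      = image_mset (\<lambda>m. F m (add_mset i (B - {#m#}))) B"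
    by (intro image_mset_cong) (simp add: diff_union_swap2)
  then show ?thesis
    by simp
qed

lemma sum_mset_pairs_swap:
  fixes f :: "'a \<Rightarrow> 'a \<Rightarrow> 'b::comm_monoid_add"
  shows "(\<Sum>n\<in>#B. \<Sum>m\<in>#B - {#n#}. f n m) = (\<Sum>n\<in>#B. \<Sum>m\<in>#B - {#n#}. f m n)"
proof (induction B)
  case (add i B)
  have "(\<Sum>n\<in>#add_mset i B. \<Sum>m\<in>#add_mset i B - {#n#}. g n m)
      = (\<Sum>m\<in>#B. g i m) + ((\<Sum>n\<in>#B. g n i) + (\<Sum>n\<in>#B. \<Sum>m\<in>#B - {#n#}. g n m))"
    for g :: "'a \<Rightarrow> 'a \<Rightarrow> 'b"
    using sum_mset_remove1_add_mset [of "\<lambda>n C. \<Sum>m\<in>#C. g n m" i B] by (simp add: sum_mset.distrib)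
  from this [of f] this [of "\<lambda>n m. f m n"] show ?case
    by (simp only: add add.left_commute)
qed simp

text \<open>This is Euler's formula: the homotopy, applied to the value \<open>h\<^sup>B (h\<^sub>i a\<^sub>j - h\<^sub>j a\<^sub>i)\<close> of \<open>h\<^sup>B D\<^sub>i\<^sub>j\<close>,
  returns a multiple of \<open>h\<^sup>B D\<^sub>i\<^sub>j\<close>. Differentiating the new factors \<open>h\<^sub>i\<close> and \<open>h\<^sub>j\<close> contributes \<open>D\<^sub>i\<^sub>j\<close>
  and \<open>- D\<^sub>j\<^sub>i\<close>. Every factor \<open>h\<^sub>m\<close> of \<open>h\<^sup>B\<close> contributes \<open>h\<^sub>i D\<^sub>m\<^sub>j - h\<^sub>j D\<^sub>m\<^sub>i\<close>, which is
  \<open>h\<^sub>m D\<^sub>i\<^sub>j\<close> by the Jacobi identity.\<close>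

lemma koszul_antisymmetrized:
  "cong_mod skew_ideal2 (koszul (add_mset i B) j - koszul (add_mset j B) i)
     (of_nat (size B + 2) * (ad_mset B (ycomm i j) :: 'k::field free_alg))"
proof -
  have exp: "koszul (add_mset i B) j
      = ad_mset B (ycomm i j) + (\<Sum>m\<in>#B. (ad_mset (add_mset i (B - {#m#})) (ycomm m j) :: 'k free_alg))" for i j
    unfolding koszul_def using sum_mset_remove1_add_mset [of "\<lambda>m C. ad_mset C (ycomm m j)" i B] by simp
  have "ycomm j i = 0 - (ycomm i j :: 'k free_alg)"
    by (simp add: comm_def)
  then have "ad_mset B (ycomm j i) = - (ad_mset B (ycomm i j) :: 'k free_alg)"
    using ad_mset_diff [of B 0 "ycomm i j :: 'k free_alg"] ad_mset_diff [of B 0 "0 :: 'k free_alg"] by simp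
  then have "koszul (add_mset i B) j - koszul (add_mset j B) i = 2 * (ad_mset B (ycomm i j) :: 'k free_alg)
      + (\<Sum>m\<in>#B. ad_mset (add_mset i (B - {#m#})) (ycomm m j) - ad_mset (add_mset j (B - {#m#})) (ycomm m i))"
    by (simp add: exp [of i j] exp [of j i] sum_mset_subtractf mult_2)
  also have "cong_mod skew_ideal2 \<dots> (2 * ad_mset B (ycomm i j) + (\<Sum>m\<in>#B. ad_mset B (ycomm i j)))"
  proof (intro S2.cong_add S2.cong_refl S2.cong_sum_mset)
    fix m assume m: "m \<in># B"
    let ?C = "B - {#m#}"
    have "cong_mod skew_ideal2 (ad_mset (add_mset i ?C) (ycomm m j) - ad_mset (add_mset j ?C) (ycomm m i))
        (ad_mset ?C (comm (yv i) (ycomm m j) :: 'k free_alg) - ad_mset ?C (comm (yv j) (ycomm m i)))"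
      by (intro S2.cong_diff ad_mset_add_mset ycomm_in_skew_ideal)
    also have "\<dots> = ad_mset ?C (comm (yv m) (ycomm i j))"
      unfolding ad_mset_diff [symmetric] by (simp add: comm_def algebra_simps)
    also have "cong_mod skew_ideal2 \<dots> (ad_mset (add_mset m ?C) (ycomm i j))"
      by (intro S2.cong_sym [OF ad_mset_add_mset(2)] ycomm_in_skew_ideal)
    finally show "cong_mod skew_ideal2
        (ad_mset (add_mset i ?C) (ycomm m j) - ad_mset (add_mset j ?C) (ycomm m i))
        (ad_mset B (ycomm i j) :: 'k free_alg)"
      using m by simp
  qed
  finally show ?thesis
    by (simp add: algebra_simps mult_2)
qed

lemma koszul2_symmetric: "koszul2 B j k \<simeq> (koszul2 B k j :: 'k::field_char_0 free_alg)"
proof -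
  define f where "f j k n m = ad_mset (B - {#n#} - {#m#}) (ycomm m j) * (ycomm n k :: 'k free_alg)"
    for j k m n
  have exp: "(koszul2 B j k :: 'k free_alg) = (\<Sum>n\<in>#B. \<Sum>m\<in>#B - {#n#}. f j k n m)" for j k
    by (simp add: koszul2_def koszul_def f_def sum_mset_distrib_right)
  have "(\<Sum>n\<in>#B. \<Sum>m\<in>#B - {#n#}. f j k n m) \<simeq> (\<Sum>n\<in>#B. \<Sum>m\<in>#B - {#n#}. f k j m n)"
  proof (intro I.cong_sum_mset)
    fix n m
    show "f j k n m \<simeq> f k j m n"
      unfolding f_def diff_right_commute [of B "{#n#}" "{#m#}"]
      by (intro ad_mset_exchange ycomm_basic)
  qed
  also have "\<dots> = (\<Sum>n\<in>#B. \<Sum>m\<in>#B - {#n#}. f k j n m)"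
    by (rule sum_mset_pairs_swap)
  finally show ?thesis
    by (simp add: exp)
qed

text \<open>Differentiating the new factors \<open>h\<^sub>i\<close> and \<open>h\<^sub>j\<close> in the outer sum leaves
  \<open>D\<^sub>m\<^sub>j D\<^sub>i\<^sub>l - D\<^sub>m\<^sub>i D\<^sub>j\<^sub>l\<close>, which the Pluecker relation turns into \<open>D\<^sub>m\<^sub>l D\<^sub>i\<^sub>j\<close>. In the other summands the
  inner sum is the previous formula for a multiset with one element less. Together
  these are \<open>1 + (size B + 1)\<close> copies of the right-hand side.\<close>

lemma koszul2_antisymmetrized1:
  "koszul2 (add_mset i B) j l - koszul2 (add_mset j B) i l
     \<simeq> of_nat (size B + 2) * (koszul B l * (ycomm i j :: 'k::field_char_0 free_alg))"
proof -
  have exp: "koszul2 (add_mset i B) j l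
      = koszul B j * ycomm i l + (\<Sum>n\<in>#B. koszul (add_mset i (B - {#n#})) j * (ycomm n l :: 'k free_alg))" for i j
    unfolding koszul2_def
    using sum_mset_remove1_add_mset [of "\<lambda>n C. koszul C j * ycomm n l" i B] by simp
  have "koszul2 (add_mset i B) j l - koszul2 (add_mset j B) i l
      = (\<Sum>m\<in>#B. ad_mset (B - {#m#}) (ycomm m j) * (ycomm i l :: 'k free_alg) - ad_mset (B - {#m#}) (ycomm m i) * ycomm j l)
        + (\<Sum>n\<in>#B. (koszul (add_mset i (B - {#n#})) j - koszul (add_mset j (B - {#n#})) i) * ycomm n l)"
    by (simp add: exp [of i j] exp [of j i] koszul_def [of B] sum_mset_subtractf
        sum_mset_distrib_right left_diff_distrib)
  also have "\<dots> \<simeq> (\<Sum>m\<in>#B. ad_mset (B - {#m#}) (ycomm m l) * ycomm i j)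
        + (\<Sum>n\<in>#B. of_nat (size B + 1) * (ad_mset (B - {#n#}) (ycomm n l) * ycomm i j))"
  proof (intro I.cong_add I.cong_sum_mset ad_mset_plucker)
    fix n assume n: "n \<in># B"
    let ?C = "B - {#n#}"
    have "(koszul (add_mset i ?C) j - koszul (add_mset j ?C) i) * ycomm n l
        \<simeq> of_nat (size ?C + 2) * ad_mset ?C (ycomm i j) * (ycomm n l :: 'k free_alg)"
      by (intro cong2_mult_right koszul_antisymmetrized ycomm_in_skew_ideal)
    also have "\<dots> = of_nat (size B + 1) * (ad_mset ?C (ycomm i j) * ycomm n l)"
      using size_Suc_Diff1 [OF n] by (simp only: mult.assoc add_2_eq_Suc' Suc_eq_plus1)
    also have "\<dots> \<simeq> of_nat (size B + 1) * (ad_mset ?C (ycomm n l) * ycomm i j)"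
      by (intro I.cong_mult_left ad_mset_exchange ycomm_basic)
    finally show "(koszul (add_mset i ?C) j - koszul (add_mset j ?C) i) * ycomm n l
        \<simeq> of_nat (size B + 1) * (ad_mset ?C (ycomm n l) * (ycomm i j :: 'k free_alg))" .
  qed
  also have "\<dots> = koszul B l * ycomm i j + of_nat (size B + 1) * (koszul B l * ycomm i j)"
    by (simp only: koszul_def sum_mset_distrib_left sum_mset_distrib_right)
  also have "\<dots> = of_nat (size B + 2) * (koszul B l * ycomm i j)"
    by (simp add: distrib_right)
  finally show ?thesis .
qed

text \<open>The left-hand side is \<open>koszul2\<close> applied to the four terms of
  \<open>h\<^sup>B (h\<^sub>i a\<^sub>j - h\<^sub>j a\<^sub>i) (h\<^sub>k a\<^sub>l - h\<^sub>l a\<^sub>k)\<close>, the value of \<open>h\<^sup>B D\<^sub>i\<^sub>j D\<^sub>k\<^sub>l\<close>. Antisymmetrizing in \<open>i, j\<close> splits off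
  \<open>D\<^sub>i\<^sub>j\<close> and leaves the case of one factor for \<open>k, l\<close>.\<close>

lemma koszul2_antisymmetrized:
  "koszul2 (add_mset i (add_mset k B)) j l - koszul2 (add_mset j (add_mset k B)) i l
     - (koszul2 (add_mset i (add_mset l B)) j k - koszul2 (add_mset j (add_mset l B)) i k)
   \<simeq> of_nat ((size B + 3) * (size B + 2))
       * (ad_mset B (ycomm i j) * (ycomm k l :: 'k::field_char_0 free_alg))"
proof -
  let ?n = "of_nat (size B + 3) :: 'k free_alg"
  have "koszul2 (add_mset i (add_mset k B)) j l - koszul2 (add_mset j (add_mset k B)) i l
     - (koszul2 (add_mset i (add_mset l B)) j k - koszul2 (add_mset j (add_mset l B)) i k)
    \<simeq> ?n * (koszul (add_mset k B) l * ycomm i j) - ?n * (koszul (add_mset l B) k * ycomm i j)"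
    using koszul2_antisymmetrized1 [of i "add_mset k B" j l]
      koszul2_antisymmetrized1 [of i "add_mset l B" j k]
    by (intro I.cong_diff) (simp_all add: eval_nat_numeral)
  also have "\<dots> = ?n * ((koszul (add_mset k B) l - koszul (add_mset l B) k) * ycomm i j)"
    by (simp add: algebra_simps)
  also have "\<dots> \<simeq> ?n * (of_nat (size B + 2) * ad_mset B (ycomm k l) * ycomm i j)"
    by (intro I.cong_mult_left cong2_mult_right koszul_antisymmetrized ycomm_in_skew_ideal)
  also have "\<dots> = of_nat ((size B + 3) * (size B + 2)) * (ad_mset B (ycomm k l) * ycomm i j)"
    by (simp only: of_nat_mult mult.assoc)
  also have "\<dots> \<simeq> of_nat ((size B + 3) * (size B + 2)) * (ad_mset B (ycomm i j) * ycomm k l)"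
    by (intro I.cong_mult_left ad_mset_exchange ycomm_basic)
  finally show ?thesis .
qed

section \<open>Linear independence of monomials\<close>

text \<open>Dedekind's argument: multiply the relation by \<open>\<xi> n q\<close>, and also translate its argument by \<open>q\<close>;
  in the difference the character \<open>\<xi> n\<close> is gone. Monomials, as functions of a point, are
  such characters of the points under componentwise multiplication.\<close>

lemma characters_independent:
  fixes \<xi> :: "'m \<Rightarrow> 'p \<Rightarrow> 'k::field"
  assumes mult: "\<And>m p q. \<xi> m (f p q) = \<xi> m p * \<xi> m q" and one: "\<And>m. \<xi> m e = 1"
    and inj: "inj \<xi>"
    and "finite T" "\<And>p. (\<Sum>m\<in>T. c m * \<xi> m p) = 0" "m \<in> T"
  shows "c m = 0"
  using assms(4-6)
proof (induction T arbitrary: c m)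
  case (insert n T)
  have zero: "c m = 0" if m: "m \<in> T" for m
  proof -
    from m insert.hyps(2) inj obtain q where q: "\<xi> m q \<noteq> \<xi> n q"
      by (metis ext injD)
    have "(\<Sum>m\<in>T. c m * (\<xi> m q - \<xi> n q) * \<xi> m p) = 0" for p
    proof -
      have "(\<Sum>m\<in>T. c m * (\<xi> m q - \<xi> n q) * \<xi> m p)
          = (\<Sum>m\<in>insert n T. c m * (\<xi> m q - \<xi> n q) * \<xi> m p)"
        using insert.hyps by simp
      also have "\<dots> = (\<Sum>m\<in>insert n T. c m * \<xi> m (f p q)) - \<xi> n q * (\<Sum>m\<in>insert n T. c m * \<xi> m p)"
        by (simp add: mult sum_distrib_left sum_subtractf algebra_simps del: sum.insert)
      finally show ?thesis
        by (simp only: insert.prems(1)) simp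
    qed
    from insert.IH [OF this m] have "c m * (\<xi> m q - \<xi> n q) = 0" .
    with q show ?thesis
      by simp
  qed
  have "c n = 0"
    using insert.prems(1) [of e] insert.hyps zero by (simp add: one)
  with zero insert.prems(2) show ?case
    by blast
qed simp

text \<open>The triple \<open>(A, B, C)\<close> stands for the monomial \<open>d\<^sup>A h\<^sup>B \<alpha>\<^sup>C\<close>. The variable \<open>\<alpha> (Sym j)\<close> is the
  \<open>a\<^sub>j\<close>, and \<open>\<alpha> (Skew i)\<close> the \<open>z\<^sub>i\<close> of the introduction.\<close>

type_synonym monomial = "nat multiset \<times> nat multiset \<times> letter multiset"
type_synonym 'k point = "(nat \<Rightarrow> 'k) \<times> (nat \<Rightarrow> 'k) \<times> (letter \<Rightarrow> 'k)"

definition monomial_val :: "monomial \<Rightarrow> 'k::field point \<Rightarrow> 'k" where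
  "monomial_val = (\<lambda>(A, B, C) (d, h, \<alpha>). (\<Prod>i\<in>#A. d i) * (\<Prod>i\<in>#B. h i) * (\<Prod>x\<in>#C. \<alpha> x))"

lemma inj_monomial_val: "inj (monomial_val :: monomial \<Rightarrow> 'k::field_char_0 point \<Rightarrow> 'k)"
proof (rule injI)
  fix m m' :: monomial assume eq: "monomial_val m = (monomial_val m' :: 'k point \<Rightarrow> 'k)"
  obtain A B C A' B' C' where m: "m = (A, B, C)" "m' = (A', B', C')"
    by (metis prod_cases3)
  have pow: "(\<Prod>i\<in>#M. if i = j then 2 else 1) = (2 :: 'k) ^ count M j" for M :: "'b multiset" and j
    by (induction M) auto
  have "(2 :: 'k) ^ n = 2 ^ n' \<longleftrightarrow> n = n'" for n n' :: nat
    using of_nat_eq_iff [of "2 ^ n" "2 ^ n'", where ?'a = 'k] by simp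
  note pow = pow this
  have "A = A'"
    using fun_cong [OF eq, of "(\<lambda>i. if i = _ then 2 else 1, \<lambda>_. 1, \<lambda>_. 1)"]
    by (intro multiset_eqI) (simp add: m monomial_val_def pow)
  moreover have "B = B'"
    using fun_cong [OF eq, of "(\<lambda>_. 1, \<lambda>i. if i = _ then 2 else 1, \<lambda>_. 1)"]
    by (intro multiset_eqI) (simp add: m monomial_val_def pow)
  moreover have "C = C'"
    using fun_cong [OF eq, of "(\<lambda>_. 1, \<lambda>_. 1, \<lambda>i. if i = _ then 2 else 1)"]
    by (intro multiset_eqI) (simp add: m monomial_val_def pow)
  ultimately show "m = m'"
    by (simp add: m)
qed

lemma monomial_val_independent:
  fixes P :: "monomial \<Rightarrow>\<^sub>0 'k::field_char_0"
  assumes "\<And>v. (\<Sum>m\<in>Poly_Mapping.keys P. Poly_Mapping.lookup P m * monomial_val m v) = 0"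
  shows "P = 0"
proof -
  let ?mult = "\<lambda>(d, h, \<alpha>) (d', h', \<alpha>'). (\<lambda>i. d i * d' i, \<lambda>i. h i * h' i, \<lambda>x. \<alpha> x * \<alpha>' x) :: 'k point"
  have "Poly_Mapping.lookup P m = 0" if "m \<in> Poly_Mapping.keys P" for m
    by (rule characters_independent [of monomial_val ?mult "(\<lambda>_. 1, \<lambda>_. 1, \<lambda>_. 1)",
          OF _ _ inj_monomial_val finite_keys assms that])
      (auto simp: monomial_val_def prod_mset.distrib split: prod.splits)
  then show ?thesis
    by (metis in_keys_iff lookup_zero poly_mapping_eqI)
qed

section \<open>Reading off an element from its values\<close>

text \<open>In one layer, \<open>ev\<close> is, up to sign, a matrix entry that vanishes on \<open>W\<close>, and \<open>\<Psi>\<close> proposes a preimage for each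
  monomial. The elements whose value is a polynomial, and which the linear extension of
  \<open>\<Psi>\<close> recovers from this polynomial modulo \<open>W\<close>, form the subspace \<open>represented\<close>. On it, a
  vanishing value forces membership in \<open>W\<close>.\<close>

locale normal_form = ring_ideal W for W :: "'k::field_char_0 free_alg set" +
  fixes ev :: "'k point \<Rightarrow> 'k free_alg \<Rightarrow> 'k" and \<Psi> :: "monomial \<Rightarrow> 'k free_alg"
  assumes ev_add: "ev v (x + y) = ev v x + ev v y"
    and ev_scalar: "ev v (scalar c * x) = c * ev v x"
    and ev_ideal: "x \<in> W \<Longrightarrow> ev v x = 0"
begin

definition pval :: "(monomial \<Rightarrow>\<^sub>0 'k) \<Rightarrow> 'k point \<Rightarrow> 'k" where
  "pval P v = (\<Sum>m\<in>Poly_Mapping.keys P. Poly_Mapping.lookup P m * monomial_val m v)"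

definition pmap :: "(monomial \<Rightarrow>\<^sub>0 'k) \<Rightarrow> 'k free_alg" where
  "pmap P = (\<Sum>m\<in>Poly_Mapping.keys P. scalar (Poly_Mapping.lookup P m) * \<Psi> m)"

definition represented :: "'k free_alg set" where
  "represented = {x. \<exists>P. (\<forall>v. ev v x = pval P v) \<and> cong_mod W x (pmap P)}"

lemma p_zero: "pval 0 v = 0" "pmap 0 = 0"
  by (simp_all add: pval_def pmap_def)

lemma p_add: "pval (P + Q) v = pval P v + pval Q v" "pmap (P + Q) = pmap P + pmap Q"
  unfolding pval_def pmap_def
  by (rule setsum_keys_plus_distrib, simp_all add: scalar_simps distrib_right)+

lemma p_single: "pval (Poly_Mapping.single m c) v = c * monomial_val m v"
  "pmap (Poly_Mapping.single m c) = scalar c * \<Psi> m"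
  by (cases "c = 0"; simp add: pval_def pmap_def scalar_simps)+

lemma p_sum: "pval (\<Sum>m\<in>T. Poly_Mapping.single m (c m)) v = (\<Sum>m\<in>T. c m * monomial_val m v)"
  "pmap (\<Sum>m\<in>T. Poly_Mapping.single m (c m)) = (\<Sum>m\<in>T. scalar (c m) * \<Psi> m)"
  by (induction T rule: infinite_finite_induct) (simp_all add: p_zero p_add p_single)

lemma in_represented_add:
  assumes "x \<in> represented" "y \<in> represented"
  shows "x + y \<in> represented"
proof -
  obtain P Q where "\<forall>v. ev v x = pval P v" "cong_mod W x (pmap P)"
    "\<forall>v. ev v y = pval Q v" "cong_mod W y (pmap Q)"
    using assms unfolding represented_def by blast
  then have "\<forall>v. ev v (x + y) = pval (P + Q) v" "cong_mod W (x + y) (pmap (P + Q))"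
    by (simp_all add: p_add ev_add cong_add)
  then show ?thesis
    unfolding represented_def by blast
qed

lemma in_represented_scalar:
  assumes "x \<in> represented"
  shows "scalar c * x \<in> represented"
proof -
  obtain P where P: "\<forall>v. ev v x = pval P v" "cong_mod W x (pmap P)"
    using assms unfolding represented_def by blast
  let ?Q = "\<Sum>m\<in>Poly_Mapping.keys P. Poly_Mapping.single m (c * Poly_Mapping.lookup P m)"
  have "ev v (scalar c * x) = pval ?Q v" for v
    unfolding p_sum ev_scalar P(1) [rule_format]
    by (simp add: pval_def sum_distrib_left mult.assoc)
  moreover have "cong_mod W (scalar c * x) (pmap ?Q)"
    using cong_mult_left [OF P(2), of "scalar c"] unfolding p_sum
    by (simp add: pmap_def sum_distrib_left scalar_simps mult.assoc)
  ultimately show ?thesis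
    unfolding represented_def by blast
qed

lemma in_represented_ideal: "x \<in> W \<Longrightarrow> x \<in> represented"
  unfolding represented_def by (auto intro!: exI [of _ 0] simp: p_zero ev_ideal cong_mod_def)

lemma in_represented_cong:
  assumes "cong_mod W x y" "y \<in> represented"
  shows "x \<in> represented"
  using in_represented_add [OF in_represented_ideal, of "x - y" y] assms by (simp add: cong_mod_def)

lemma in_represented_list:
  assumes "\<And>v. ev v x = (\<Sum>(c, m)\<leftarrow>ps. c * monomial_val m v)"
    and "cong_mod W x (\<Sum>(c, m)\<leftarrow>ps. scalar c * \<Psi> m)"
  shows "x \<in> represented"
proof -
  define P where "P = (\<Sum>(c, m)\<leftarrow>ps. Poly_Mapping.single m c)"
  have "pval P v = (\<Sum>(c, m)\<leftarrow>ps. c * monomial_val m v)" for v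
    unfolding P_def by (induction ps) (auto simp: p_zero p_add p_single)
  then have "ev v x = pval P v" for v
    by (simp only: assms(1))
  moreover have "pmap P = (\<Sum>(c, m)\<leftarrow>ps. scalar c * \<Psi> m)"
    unfolding P_def by (induction ps) (auto simp: p_zero p_add p_single)
  then have "cong_mod W x (pmap P)"
    by (simp only: assms(2))
  ultimately show ?thesis
    unfolding represented_def by blast
qed

lemma represented_vanishing:
  assumes "x \<in> represented" "\<And>v. ev v x = 0"
  shows "x \<in> W"
proof -
  obtain P where P: "\<forall>v. ev v x = pval P v" "cong_mod W x (pmap P)"
    using assms unfolding represented_def by blast
  have "pval P v = 0" for v
    using P(1) assms(2) [of v] by metis
  then have "P = 0"
    unfolding pval_def by (rule monomial_val_independent)
  with P(2) show ?thesis
    by (simp add: p_zero cong_mod_def)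
qed

end

section \<open>Generic evaluations\<close>

text \<open>The second diagonal entry is written as \<open>d - h\<close> because commutation with \<open>y\<^sub>i\<close> multiplies the
  \<open>(1,2)\<close> entry by the difference \<open>h\<^sub>i\<close> of the diagonal entries. The corner entry is zero: on the
  squares of radical elements, where the \<open>(1,3)\<close> entry is used, it has no influence.\<close>

definition generic :: "'k::field point \<Rightarrow> letter \<Rightarrow> 'k ^ 3 ^ 3" where
  "generic = (\<lambda>(d, h, \<alpha>). case_letter
     (\<lambda>i. A_mat (d i) (d i - h i) (\<alpha> (Sym i)) (\<alpha> (Sym i)) 0)
     (\<lambda>i. A_mat 0 0 (\<alpha> (Skew i)) (- \<alpha> (Skew i)) 0))"

lemma star_assignment_generic: "star_assignment (generic v :: letter \<Rightarrow> 'k::field_char_0 ^ 3 ^ 3)"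
  by (cases v) (auto simp: star_assignment_def generic_def A_plus_eq A_minus_eq)

definition entry :: "3 \<Rightarrow> 3 \<Rightarrow> 'k::field point \<Rightarrow> 'k free_alg \<Rightarrow> 'k" where
  "entry i j v x = eval_poly (generic v) x $ i $ j"

lemma entry_add: "entry i j v (x + y) = entry i j v x + entry i j v y"
  and entry_diff: "entry i j v (x - y) = entry i j v x - entry i j v y"
  and entry_zero: "entry i j v 0 = 0"
  and entry_scalar: "entry i j v (scalar c * x) = c * entry i j v x"
  by (simp_all add: entry_def eval_poly_add eval_poly_diff eval_poly_zero eval_poly_scalar
      map_matrix_def)

lemma eval_generic:
  fixes x :: "'k::field_char_0 free_alg"
  shows "eval_poly (generic v) x = A_mat (entry 1 1 v x) (entry 2 2 v x) (entry 1 2 v x)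
    (entry 2 3 v x) (entry 1 3 v x)"
proof -
  obtain d g a b c where "eval_poly (generic v) x = A_mat d g a b c"
    using eval_poly_in_A_alg [OF star_assignment_generic] unfolding A_alg_def by blast
  then show ?thesis
    by (simp add: entry_def) (simp add: A_mat_def vector_3)
qed

lemma entry_mult:
  fixes x y :: "'k::field_char_0 free_alg"
  shows "entry 1 1 v (x * y) = entry 1 1 v x * entry 1 1 v y"
    "entry 2 2 v (x * y) = entry 2 2 v x * entry 2 2 v y"
    "entry 1 2 v (x * y) = entry 1 1 v x * entry 1 2 v y + entry 1 2 v x * entry 2 2 v y"
    "entry 2 3 v (x * y) = entry 2 2 v x * entry 2 3 v y + entry 2 3 v x * entry 1 1 v y"
    "entry 1 3 v (x * y) = entry 1 1 v x * entry 1 3 v y + entry 1 2 v x * entry 2 3 v y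
       + entry 1 3 v x * entry 1 1 v y"
proof -
  have "eval_poly (generic v) (x * y) = eval_poly (generic v) x ** eval_poly (generic v) y"
    by (rule eval_poly_mult)
  then have "entry 1 1 v (x * y) = entry 1 1 v x * entry 1 1 v y \<and>
    entry 2 2 v (x * y) = entry 2 2 v x * entry 2 2 v y \<and>
    entry 1 2 v (x * y) = entry 1 1 v x * entry 1 2 v y + entry 1 2 v x * entry 2 2 v y \<and>
    entry 2 3 v (x * y) = entry 2 2 v x * entry 2 3 v y + entry 2 3 v x * entry 1 1 v y \<and>
    entry 1 3 v (x * y) = entry 1 1 v x * entry 1 3 v y + entry 1 2 v x * entry 2 3 v y
       + entry 1 3 v x * entry 1 1 v y"
    unfolding eval_generic A_mat_mult A_mat_eq_iff by blast
  then show "entry 1 1 v (x * y) = entry 1 1 v x * entry 1 1 v y"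
    "entry 2 2 v (x * y) = entry 2 2 v x * entry 2 2 v y"
    "entry 1 2 v (x * y) = entry 1 1 v x * entry 1 2 v y + entry 1 2 v x * entry 2 2 v y"
    "entry 2 3 v (x * y) = entry 2 2 v x * entry 2 3 v y + entry 2 3 v x * entry 1 1 v y"
    "entry 1 3 v (x * y) = entry 1 1 v x * entry 1 3 v y + entry 1 2 v x * entry 2 3 v y
       + entry 1 3 v x * entry 1 1 v y"
    by blast+
qed

lemma entry_one: "entry 1 1 v 1 = 1"
  by (simp add: entry_def eval_poly_one mat_def)

lemma entry_gen:
  "entry 1 1 (d, h, \<alpha>) (yv i) = d i" "entry 2 2 (d, h, \<alpha>) (yv i) = d i - h i"
  "entry 1 2 (d, h, \<alpha>) (yv i) = \<alpha> (Sym i)" "entry 2 3 (d, h, \<alpha>) (yv i) = \<alpha> (Sym i)"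
  "entry 1 1 (d, h, \<alpha>) (zv i) = 0" "entry 2 2 (d, h, \<alpha>) (zv i) = 0"
  "entry 1 2 (d, h, \<alpha>) (zv i) = \<alpha> (Skew i)" "entry 2 3 (d, h, \<alpha>) (zv i) = - \<alpha> (Skew i)"
  by (simp_all add: entry_def eval_poly_gen generic_def A_mat_def vector_3)

lemma entry_ycomm:
  fixes d h :: "nat \<Rightarrow> 'k::field_char_0"
  shows "entry 1 1 v (ycomm i j) = (0 :: 'k)" "entry 2 2 v (ycomm i j) = (0 :: 'k)"
  "entry 1 2 (d, h, \<alpha>) (ycomm i j) = h i * \<alpha> (Sym j) - h j * \<alpha> (Sym i)"
  "entry 2 3 (d, h, \<alpha>) (ycomm i j) = - (h i * \<alpha> (Sym j) - h j * \<alpha> (Sym i))"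
  by (simp_all add: comm_def entry_diff entry_mult entry_gen algebra_simps)

lemma entry_skew_ideal:
  fixes x :: "'k::field_char_0 free_alg"
  assumes "x \<in> skew_ideal"
  shows "entry 1 1 v x = 0" "entry 2 2 v x = 0"
proof -
  have "entry 1 1 v x = 0 \<and> entry 2 2 v x = 0"
    using assms
  proof induction
    case (base s u w)
    then show ?case
      by (cases v) (auto simp: basic_skew_def entry_mult entry_gen entry_ycomm)
  qed (simp_all add: entry_zero entry_add)
  then show "entry 1 1 v x = 0" "entry 2 2 v x = 0"
    by blast+
qed

lemma entry_skew_ideal2:
  fixes x :: "'k::field_char_0 free_alg"
  assumes "x \<in> skew_ideal2"
  shows "entry 1 1 v x = 0" "entry 1 2 v x = 0" "entry 2 3 v x = 0"
proof -
  have "entry 1 1 v x = 0 \<and> entry 1 2 v x = 0 \<and> entry 2 3 v x = 0"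
    using assms by induction (simp_all add: entry_mult entry_zero entry_add entry_skew_ideal)
  then show "entry 1 1 v x = 0" "entry 1 2 v x = 0" "entry 2 3 v x = 0"
    by blast+
qed

lemma gen_ideal_subset_Id_star_A: "(gen_ideal :: 'k::field_char_0 free_alg set) \<subseteq> Id_star_A"
  by (intro hull_minimal generators_subset_Id_star_A T_star_ideal_Id_star_A)

lemma entry_Id_star_A: "x \<in> Id_star_A \<Longrightarrow> entry i j v x = (0 :: 'k::field_char_0)"
  using star_assignment_generic [of v] by (simp add: Id_star_A_iff entry_def)

lemma entry_ymonom: "entry 1 1 (d, h, \<alpha>) (ymonom A) = (\<Prod>i\<in>#A. d i :: 'k::field_char_0)"
proof -
  have "entry 1 1 (d, h, \<alpha>) (yprod U) = prod_list (map d U)" for U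
    by (induction U) (simp_all add: yprod_def entry_one entry_mult entry_gen)
  then show ?thesis
    unfolding ymonom_def by (metis mset_map mset_sorted_list_of_multiset prod_mset_prod_list)
qed

lemma entry_ad_mset:
  fixes x :: "'k::field_char_0 free_alg"
  assumes "x \<in> skew_ideal"
  shows "entry 1 2 (d, h, \<alpha>) (ad_mset B x) = (\<Prod>i\<in>#B. h i) * entry 1 2 (d, h, \<alpha>) x"
proof -
  have "entry 1 2 (d, h, \<alpha>) (ad L x) = prod_list (map h L) * entry 1 2 (d, h, \<alpha>) x" for L
    by (induction L)
      (simp_all add: comm_def entry_diff entry_mult entry_gen entry_skew_ideal ad_in_skew_ideal
        assms algebra_simps)
  then show ?thesis
    unfolding ad_mset_def by (metis mset_map mset_sorted_list_of_multiset prod_mset_prod_list)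
qed

section \<open>The three layers\<close>

lemma word_dichotomy:
  "prod_list (map gen xs) \<in> skew_ideal \<or> (\<exists>U. prod_list (map gen xs) = (yprod U :: 'k::field free_alg))"
proof (induction xs)
  case Nil
  have "prod_list (map gen []) = yprod []"
    by (simp add: yprod_def)
  then show ?case
    by blast
next
  case (Cons x xs)
  show ?case
  proof (cases x)
    case (Sym i)
    then show ?thesis
      using Cons S.mult_left [of _ "yv i"] by (auto simp: yprod_def intro: exI [of _ "i # _"])
  next
    case (Skew i)
    then show ?thesis
      by (simp add: S.mult_right zv_in_skew_ideal)
  qed
qed

interpretation L1: normal_form "skew_ideal :: 'k::field_char_0 free_alg set" "entry 1 1"
  "\<lambda>(A, B, C). ymonom A"
  by unfold_locales (simp_all add: entry_add entry_scalar entry_skew_ideal)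

text \<open>A word without \<open>z\<close> agrees modulo \<open>skew_ideal\<close> with its sorted version, which its value \<open>d\<^sup>A\<close>
  determines; all other words lie in \<open>skew_ideal\<close>.\<close>

lemma layer1:
  fixes x :: "'k::field_char_0 free_alg"
  assumes "\<And>v. entry 1 1 v x = 0"
  shows "x \<in> skew_ideal"
proof -
  have yprod: "(ymonom (mset U) :: 'k free_alg) \<in> L1.represented" for U
    by (rule L1.in_represented_list [of _ "[(1, (mset U, {#}, {#}))]"])
      (auto simp: entry_ymonom monomial_val_def scalar_simps S.cong_refl)
  have "(prod_list (map gen xs) :: 'k free_alg) \<in> L1.represented" for xs
    using word_dichotomy [of xs]
    by (metis L1.in_represented_cong L1.in_represented_ideal yprod yprod_ymonom)
  then have "x \<in> L1.represented"
    by (induction x rule: free_alg_induct)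
      (simp_all add: L1.in_represented_ideal S.zero single_letters L1.in_represented_scalar
        L1.in_represented_add)
  then show ?thesis
    using assms by (rule L1.represented_vanishing)
qed

text \<open>In \<open>u s v\<close> a letter \<open>z\<close> outside \<open>s\<close> gives an element of the square. A letter \<open>y\<^sub>i\<close> to the
  right of \<open>ad L s\<close> can be moved to its left at the price of a commutator, that is, of a longer
  list \<open>L\<close>.\<close>

lemma skew_ideal_spanned:
  fixes V :: "'k::field free_alg set"
  assumes add: "\<And>x y. x \<in> V \<Longrightarrow> y \<in> V \<Longrightarrow> x + y \<in> V"
    and scalar: "\<And>c x. x \<in> V \<Longrightarrow> scalar c * x \<in> V"
    and square: "skew_ideal2 \<subseteq> V"
    and basis: "\<And>U L s. s \<in> basic_skew \<Longrightarrow> yprod U * ad L s \<in> V"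
  shows "skew_ideal \<subseteq> V"
proof
  have diff: "x - y \<in> V" if "x \<in> V" "y \<in> V" for x y
    using add [OF that(1) scalar [OF that(2), of "- 1"]] by (simp add: scalar_simps)
  have right: "yprod U * ad L s * v \<in> V" if s: "s \<in> basic_skew" for U L s v
  proof (induction v arbitrary: U L rule: free_alg_gen_induct)
    case (gen x v)
    show ?case
    proof (cases x)
      case (Sym i)
      have "yprod U * ad L s * (yv i * v) = yprod (U @ [i]) * ad L s * v - yprod U * ad (i # L) s * v"
        by (simp add: yprod_def comm_def algebra_simps)
      then show ?thesis
        by (simp add: Sym diff gen.IH del: ad_simps)
    next
      case (Skew i)
      have "yprod U * ad L s * (zv i * v) \<in> skew_ideal2"
        by (intro skew_ideal2.mult S.mult_left S.mult_right ad_in_skew_ideal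
            basic_skew_in_skew_ideal s zv_in_skew_ideal)
      with square show ?thesis
        by (auto simp: Skew)
    qed
  next
    case (scalar c v)
    have "yprod U * ad L s * (scalar c * v) = scalar c * (yprod U * ad L s * v)"
      by (metis mult.assoc scalar_commute)
    then show ?case
      by (simp add: assms(2) scalar.IH)
  qed (simp_all add: basis s distrib_left add)
  have both: "u * s * v \<in> V" if s: "s \<in> basic_skew" for u s v
  proof (induction u rule: free_alg_induct)
    case zero
    show ?case
      using square skew_ideal2.zero by auto
  next
    case (single w c)
    have "prod_list (map gen (letters w)) * s * v \<in> V"
    proof (cases "prod_list (map gen (letters w)) \<in> (skew_ideal :: 'k free_alg set)")
      case True
      then have "prod_list (map gen (letters w)) * (s * v) \<in> skew_ideal2"
        by (rule skew_ideal2.mult [OF _ S.mult_right [OF basic_skew_in_skew_ideal [OF s]]])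
      with square show ?thesis
        by (auto simp: mult.assoc)
    next
      case False
      then obtain U where "prod_list (map gen (letters w)) = (yprod U :: 'k free_alg)"
        using word_dichotomy by blast
      then show ?thesis
        using right [OF s, of U "[]"] by simp
    qed
    then show ?case
      by (simp add: single_letters mult.assoc scalar)
  qed (simp add: distrib_right add)
  fix x :: "'k free_alg" assume "x \<in> skew_ideal"
  then show "x \<in> V"
    by induction (use square skew_ideal2.zero in \<open>auto simp: both add\<close>)
qed

lemma yprod_ad_normal:
  assumes "x \<in> skew_ideal"
  shows "cong_mod skew_ideal2 (yprod U * ad L x) (ymonom (mset U) * ad_mset (mset L) x)"
proof -
  have "cong_mod skew_ideal2 (yprod U * ad L x) (ymonom (mset U) * ad L x)"
    using skew_ideal2.mult [OF yprod_ymonom [unfolded cong_mod_def] ad_in_skew_ideal [OF assms]]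
    by (simp add: cong_mod_def left_diff_distrib)
  also have "cong_mod skew_ideal2 \<dots> (ymonom (mset U) * ad_mset (mset L) x)"
    by (intro S2.cong_mult_left ad_ad_mset assms)
  finally show ?thesis .
qed

lemma scalar_cancel:
  fixes p q :: "'k::field_char_0 free_alg"
  assumes "n \<noteq> 0"
  shows "scalar (1 / of_nat n) * (p * (of_nat n * q)) = p * q"
proof -
  have "p * (scalar (of_nat n) * q) = scalar (of_nat n) * (p * q)"
    by (metis mult.assoc scalar_commute)
  then have "scalar (1 / of_nat n) * (p * (scalar (of_nat n) * q)) = scalar (1 / of_nat n * of_nat n) * (p * q)"
    by (simp only: scalar_simps(6) mult.assoc)
  then show ?thesis
    using assms by (simp add: scalar_simps(2,3))
qed

text \<open>The denominator is the integer from \<open>koszul_antisymmetrized\<close>, which exceeds the degree in \<open>h\<close> of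
  the monomials there by one.\<close>

fun lift2 :: "nat multiset \<Rightarrow> nat multiset \<Rightarrow> letter \<Rightarrow> 'k::field free_alg" where
  "lift2 A B (Skew i) = ymonom A * ad_mset B (zv i)"
| "lift2 A B (Sym j) = scalar (1 / of_nat (size B + 1)) * (ymonom A * koszul B j)"

interpretation L2: normal_form "skew_ideal2 :: 'k::field_char_0 free_alg set" "entry 1 2"
  "\<lambda>(A, B, C). lift2 A B (THE x. C = {#x#})"
  by unfold_locales (simp_all add: entry_add entry_scalar entry_skew_ideal2)

text \<open>The values of \<open>y\<^sup>A ad B s\<close> are \<open>d\<^sup>A h\<^sup>B z\<^sub>i\<close> and \<open>d\<^sup>A h\<^sup>B (h\<^sub>i a\<^sub>j - h\<^sub>j a\<^sub>i)\<close>, from which \<open>lift2\<close> recovers these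
  elements modulo the square.\<close>

lemma layer2:
  fixes x :: "'k::field_char_0 free_alg"
  assumes "x \<in> skew_ideal" "\<And>v. entry 1 2 v x = 0"
  shows "x \<in> skew_ideal2"
proof -
  have normal: "ymonom A * ad_mset B s \<in> L2.represented" if s: "s \<in> basic_skew" for A B and s :: "'k free_alg"
  proof -
    consider i where "s = zv i" | i j where "s = ycomm i j"
      using s by (auto simp: basic_skew_def)
    then show ?thesis
    proof cases
      case (1 i)
      show ?thesis
        by (rule L2.in_represented_list [of _ "[(1, (A, B, {#Skew i#}))]"])
          (auto simp: 1 entry_mult entry_ymonom entry_ad_mset entry_gen entry_skew_ideal
            ad_mset_in_skew_ideal zv_in_skew_ideal monomial_val_def scalar_simps S2.cong_refl)
    next
      case (2 i j)
      let ?n = "size B + 2"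
      have "ymonom A * ad_mset B s = scalar (1 / of_nat ?n) * (ymonom A * (of_nat ?n * ad_mset B s))"
        by (simp only: scalar_cancel)
      also have "cong_mod skew_ideal2 \<dots> (scalar (1 / of_nat ?n) *
          (ymonom A * (koszul (add_mset i B) j - koszul (add_mset j B) i)))"
        unfolding 2 by (intro S2.cong_mult_left S2.cong_sym [OF koszul_antisymmetrized])
      finally have cong: "cong_mod skew_ideal2 (ymonom A * ad_mset B s) (scalar (1 / of_nat ?n) *
          (ymonom A * (koszul (add_mset i B) j - koszul (add_mset j B) i)))" .
      show ?thesis
        using cong
        by (intro L2.in_represented_list
            [of _ "[(1, (A, add_mset i B, {#Sym j#})), (- 1, (A, add_mset j B, {#Sym i#}))]"])
          (auto simp: 2 entry_mult entry_ymonom entry_ad_mset entry_ycomm entry_skew_ideal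
            ad_mset_in_skew_ideal ycomm_in_skew_ideal monomial_val_def scalar_simps algebra_simps)
    qed
  qed
  have "skew_ideal \<subseteq> (L2.represented :: 'k free_alg set)"
  proof (rule skew_ideal_spanned)
    fix U L and s :: "'k free_alg" assume "s \<in> basic_skew"
    then show "yprod U * ad L s \<in> L2.represented"
      by (intro L2.in_represented_cong [OF yprod_ad_normal normal] basic_skew_in_skew_ideal)
  qed (auto intro: L2.in_represented_add L2.in_represented_scalar L2.in_represented_ideal)
  then show ?thesis
    using assms by (intro L2.represented_vanishing) auto
qed

text \<open>By \<open>skew_ideal_spanned\<close>, applied to both factors, it suffices to treat \<open>x * (yprod U * ad L t)\<close>.
  The product \<open>yprod U\<close> is absorbed into \<open>x\<close>, and since products of two elements of
  \<open>skew_ideal\<close> are central, every commutator can be shifted from the right factor to the left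
  one with a change of sign. Only \<open>t\<close> remains on the right.\<close>

lemma skew_ideal2_spanned:
  fixes V :: "'k::field_char_0 free_alg set"
  assumes add: "\<And>x y. x \<in> V \<Longrightarrow> y \<in> V \<Longrightarrow> x + y \<in> V"
    and scalar: "\<And>c x. x \<in> V \<Longrightarrow> scalar c * x \<in> V"
    and ideal: "gen_ideal \<subseteq> V"
    and basis: "\<And>U L s t. s \<in> basic_skew \<Longrightarrow> t \<in> basic_skew \<Longrightarrow> yprod U * ad L s * t \<in> V"
  shows "skew_ideal2 \<subseteq> V"
proof
  have diff: "x - y \<in> V" if "x \<in> V" "y \<in> V" for x y
    using add [OF that(1) scalar [OF that(2), of "- 1"]] by (simp add: scalar_simps)
  have "skew_ideal \<subseteq> {x. \<forall>t\<in>basic_skew. x * t \<in> V}"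
  proof (rule skew_ideal_spanned)
    show "skew_ideal2 \<subseteq> {x. \<forall>t\<in>basic_skew. x * t \<in> V}"
      using ideal by (auto simp: skew_ideal2_mult basic_skew_in_skew_ideal)
  next
    fix c and x :: "'k free_alg"
    assume "x \<in> {x. \<forall>t\<in>basic_skew. x * t \<in> V}"
    then show "scalar c * x \<in> {x. \<forall>t\<in>basic_skew. x * t \<in> V}"
      by (simp add: mult.assoc scalar)
  qed (simp_all add: distrib_right add basis)
  then have basic: "x * t \<in> V" if "x \<in> skew_ideal" "t \<in> basic_skew" for x t
    using that by blast
  have ad: "x * ad L t \<in> V" if "x \<in> skew_ideal" "t \<in> basic_skew" for x t L
    using that(1)
  proof (induction L arbitrary: x)
    case (Cons i L)
    have Y: "ad L t \<in> skew_ideal"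
      by (intro ad_in_skew_ideal basic_skew_in_skew_ideal that)
    have "x * ad (i # L) t = (yv i * (x * ad L t) - x * ad L t * yv i) - comm (yv i) x * ad L t"
      by (simp add: comm_def algebra_simps)
    moreover have "yv i * (x * ad L t) - x * ad L t * yv i \<in> gen_ideal"
      using I.cong_sym [OF skew_ideal_prod_central [OF Cons.prems Y, of "yv i"]]
      by (simp add: cong_mod_def)
    ultimately show ?case
      using ideal Cons.IH [OF S.comm [OF Cons.prems]] by (auto intro: diff)
  qed (simp add: basic that)
  have "skew_ideal \<subseteq> {y. \<forall>x\<in>skew_ideal. x * y \<in> V}"
  proof (rule skew_ideal_spanned)
    show "skew_ideal2 \<subseteq> {y. \<forall>x\<in>skew_ideal. x * y \<in> V}"
      using ideal by (auto simp: skew_ideal2_mult)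
  next
    fix c and y :: "'k free_alg"
    assume y: "y \<in> {y. \<forall>x\<in>skew_ideal. x * y \<in> V}"
    have "x * (scalar c * y) = scalar c * (x * y)" for x
      by (metis mult.assoc scalar_commute)
    with y show "scalar c * y \<in> {y. \<forall>x\<in>skew_ideal. x * y \<in> V}"
      by (simp add: scalar)
  qed (simp_all add: distrib_left add ad S.mult_right flip: mult.assoc)
  note prod = this
  fix x :: "'k free_alg" assume "x \<in> skew_ideal2"
  then show "x \<in> V"
    by induction (use prod ideal I.zero in \<open>auto simp: add\<close>)
qed

text \<open>The denominators are the integers from \<open>koszul_antisymmetrized\<close> and \<open>koszul2_antisymmetrized\<close>,
  expressed by the degree \<open>size B\<close> in \<open>h\<close> of the monomial.\<close>

fun lift3 :: "nat multiset \<Rightarrow> nat multiset \<Rightarrow> letter \<Rightarrow> letter \<Rightarrow> 'k::field free_alg" where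
  "lift3 A B (Skew i) (Skew k) = ymonom A * (ad_mset B (zv i) * zv k)"
| "lift3 A B (Sym j) (Skew i) = scalar (1 / of_nat (size B + 1)) * (ymonom A * (koszul B j * zv i))"
| "lift3 A B (Skew i) (Sym j) = scalar (1 / of_nat (size B + 1)) * (ymonom A * (koszul B j * zv i))"
| "lift3 A B (Sym j) (Sym k) =
     scalar (1 / of_nat (size B * (size B + 1))) * (ymonom A * koszul2 B j k)"

lemma lift3_symmetric: "lift3 A B x y \<simeq> (lift3 A B y x :: 'k::field_char_0 free_alg)"
  by (cases x; cases y)
    (auto intro!: I.cong_mult_left I.cong_refl koszul2_symmetric ad_mset_exchange zv_basic)

text \<open>A monomial only knows the unordered pair of its last two variables. Since \<open>lift3\<close> is symmetric
  modulo the ideal, either order may be chosen.\<close>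

definition lift3_mset :: "monomial \<Rightarrow> 'k::field free_alg" where
  "lift3_mset = (\<lambda>(A, B, C). case SOME p. C = {#fst p, snd p#} of (x, y) \<Rightarrow> lift3 A B x y)"

lemma lift3_mset_pair: "lift3_mset (A, B, {#x, y#}) \<simeq> (lift3 A B x y :: 'k::field_char_0 free_alg)"
proof -
  define p where "p = (SOME p. {#x, y#} = {#fst p, snd p#})"
  have "{#x, y#} = {#fst p, snd p#}"
    unfolding p_def by (rule someI [of _ "(x, y)"]) simp
  then have "p = (x, y) \<or> p = (y, x)"
    by (cases p) (auto simp: add_eq_conv_ex)
  then show ?thesis
    unfolding lift3_mset_def p_def [symmetric] case_prod_conv
    using lift3_symmetric I.cong_refl by auto
qed

interpretation L3: normal_form "gen_ideal :: 'k::field_char_0 free_alg set"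
  "\<lambda>v x. - entry 1 3 v x" lift3_mset
  using gen_ideal_subset_Id_star_A
  by unfold_locales (auto simp: entry_add entry_scalar entry_Id_star_A)

text \<open>The value of \<open>y\<^sup>A ad B s t\<close> is \<open>- d\<^sup>A h\<^sup>B\<close> times the product of the values of \<open>s\<close> and \<open>t\<close>,
  so this is \<open>layer2\<close> for two factors; the sign is absorbed into the choice of \<open>ev\<close>.\<close>

lemma layer3:
  fixes x :: "'k::field_char_0 free_alg"
  assumes "x \<in> skew_ideal2" "\<And>v. entry 1 3 v x = 0"
  shows "x \<in> gen_ideal"
proof -
  have ev: "- entry 1 3 (d, h, \<alpha>) (ymonom A * (ad_mset B s * t))
      = (\<Prod>i\<in>#A. d i) * (\<Prod>i\<in>#B. h i) * entry 1 2 (d, h, \<alpha>) s * (- entry 2 3 (d, h, \<alpha>) t)"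
    if "s \<in> basic_skew" "t \<in> basic_skew" for d h \<alpha> A B and s t :: "'k free_alg"
  proof -
    have st: "ad_mset B s \<in> skew_ideal" "t \<in> skew_ideal" "ad_mset B s * t \<in> skew_ideal2"
      using that by (simp_all add: ad_mset_in_skew_ideal basic_skew_in_skew_ideal skew_ideal2.mult)
    then show ?thesis
      using that
      by (simp add: entry_mult(5) entry_skew_ideal2 entry_skew_ideal entry_ymonom entry_ad_mset
          basic_skew_in_skew_ideal)
  qed
  have zz: "(ymonom A :: 'k free_alg) * (ad_mset B (zv i) * zv k) \<in> L3.represented" for A B i k
    by (rule L3.in_represented_list [of _ "[(1, (A, B, {#Skew i, Skew k#}))]"])
      (auto simp: ev [OF zv_basic zv_basic] entry_gen monomial_val_def scalar_simps
        intro!: I.cong_sym [OF I.cong_trans [OF lift3_mset_pair]] I.cong_refl)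
  have cz: "(ymonom A :: 'k free_alg) * (ad_mset B (ycomm i j) * zv k) \<in> L3.represented" for A B i j k
  proof (rule L3.in_represented_list [of _ "[(1, (A, add_mset i B, {#Sym j, Skew k#})),
      (- 1, (A, add_mset j B, {#Sym i, Skew k#}))]"])
    let ?n = "size B + 2"
    have "ymonom A * (ad_mset B (ycomm i j) * zv k)
        = scalar (1 / of_nat ?n) * (ymonom A * (of_nat ?n * ad_mset B (ycomm i j) * (zv k :: 'k free_alg)))"
      by (simp only: scalar_cancel mult.assoc)
    also have "\<dots> \<simeq> scalar (1 / of_nat ?n) *
        (ymonom A * ((koszul (add_mset i B) j - koszul (add_mset j B) i) * zv k))"
      by (intro I.cong_mult_left cong2_mult_right S2.cong_sym [OF koszul_antisymmetrized]
          zv_in_skew_ideal)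
    also have "\<dots> = lift3 A (add_mset i B) (Sym j) (Skew k) - lift3 A (add_mset j B) (Sym i) (Skew k)"
      by (simp add: algebra_simps)
    also have "\<dots> \<simeq> lift3_mset (A, add_mset i B, {#Sym j, Skew k#}) - lift3_mset (A, add_mset j B, {#Sym i, Skew k#})"
      by (intro I.cong_diff I.cong_sym [OF lift3_mset_pair])
    finally show "ymonom A * (ad_mset B (ycomm i j) * zv k)
      \<simeq> (\<Sum>(c, m)\<leftarrow>[(1, (A, add_mset i B, {#Sym j, Skew k#})),
          (- 1, (A, add_mset j B, {#Sym i, Skew k#}))]. scalar c * (lift3_mset m :: 'k free_alg))"
      by (simp add: scalar_simps)
  qed (auto simp: ev [OF ycomm_basic zv_basic] entry_gen entry_ycomm monomial_val_def algebra_simps)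
  have cc: "(ymonom A :: 'k free_alg) * (ad_mset B (ycomm i j) * ycomm k l) \<in> L3.represented" for A B i j k l
  proof (rule L3.in_represented_list [of _
        "[(1, (A, add_mset i (add_mset k B), {#Sym j, Sym l#})),
          (- 1, (A, add_mset j (add_mset k B), {#Sym i, Sym l#})),
          (- 1, (A, add_mset i (add_mset l B), {#Sym j, Sym k#})),
          (1, (A, add_mset j (add_mset l B), {#Sym i, Sym k#}))]"])
    let ?n = "(size B + 3) * (size B + 2)"
    have "ymonom A * (ad_mset B (ycomm i j) * ycomm k l)
        = scalar (1 / of_nat ?n) * (ymonom A * (of_nat ?n * (ad_mset B (ycomm i j) * (ycomm k l :: 'k free_alg))))"
      by (rule scalar_cancel [symmetric]) simp
    also have "\<dots> \<simeq> scalar (1 / of_nat ?n) * (ymonom A *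
        (koszul2 (add_mset i (add_mset k B)) j l - koszul2 (add_mset j (add_mset k B)) i l
         - (koszul2 (add_mset i (add_mset l B)) j k - koszul2 (add_mset j (add_mset l B)) i k)))"
      by (intro I.cong_mult_left I.cong_sym [OF koszul2_antisymmetrized])
    also have "\<dots> = lift3 A (add_mset i (add_mset k B)) (Sym j) (Sym l)
        - lift3 A (add_mset j (add_mset k B)) (Sym i) (Sym l)
        - (lift3 A (add_mset i (add_mset l B)) (Sym j) (Sym k)
          - lift3 A (add_mset j (add_mset l B)) (Sym i) (Sym k))"
    proof -
      have n: "size (add_mset i (add_mset k B)) * (size (add_mset i (add_mset k B)) + 1) = ?n" for i k
        by (simp add: algebra_simps)
      show ?thesis
        by (simp only: lift3.simps n right_diff_distrib)
    qed
    also have "\<dots> \<simeq> lift3_mset (A, add_mset i (add_mset k B), {#Sym j, Sym l#})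
        - lift3_mset (A, add_mset j (add_mset k B), {#Sym i, Sym l#})
        - (lift3_mset (A, add_mset i (add_mset l B), {#Sym j, Sym k#})
          - lift3_mset (A, add_mset j (add_mset l B), {#Sym i, Sym k#}))"
      by (intro I.cong_diff I.cong_sym [OF lift3_mset_pair])
    finally show "ymonom A * (ad_mset B (ycomm i j) * ycomm k l)
      \<simeq> (\<Sum>(c, m)\<leftarrow>[(1, (A, add_mset i (add_mset k B), {#Sym j, Sym l#})),
          (- 1, (A, add_mset j (add_mset k B), {#Sym i, Sym l#})),
          (- 1, (A, add_mset i (add_mset l B), {#Sym j, Sym k#})),
          (1, (A, add_mset j (add_mset l B), {#Sym i, Sym k#}))]. scalar c * (lift3_mset m :: 'k free_alg))"
      by (simp add: scalar_simps algebra_simps)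
  qed (auto simp: ev [OF ycomm_basic ycomm_basic] entry_ycomm monomial_val_def algebra_simps)
  have normal: "ymonom A * (ad_mset B s * t) \<in> L3.represented"
    if st: "s \<in> basic_skew" "t \<in> basic_skew" for A B and s t :: "'k free_alg"
  proof -
    have swap: "ymonom A * (ad_mset B s * t) \<simeq> ymonom A * (ad_mset B t * s)"
      by (intro I.cong_mult_left ad_mset_exchange st)
    have "ymonom A * (ad_mset B s * t) \<in> L3.represented \<or> ymonom A * (ad_mset B t * s) \<in> L3.represented"
      using st by (auto simp: basic_skew_def zz cz cc)
    then show ?thesis
      by (blast intro: L3.in_represented_cong [OF swap])
  qed
  have "skew_ideal2 \<subseteq> (L3.represented :: 'k free_alg set)"
  proof (rule skew_ideal2_spanned)
    fix U L and s t :: "'k free_alg" assume st: "s \<in> basic_skew" "t \<in> basic_skew"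
    then have "yprod U * ad L s * t \<simeq> ymonom (mset U) * ad_mset (mset L) s * t"
      by (intro cong2_mult_right yprod_ad_normal basic_skew_in_skew_ideal)
    then show "yprod U * ad L s * t \<in> L3.represented"
      using normal [OF st] by (auto intro: L3.in_represented_cong simp: mult.assoc)
  qed (auto intro: L3.in_represented_add L3.in_represented_scalar L3.in_represented_ideal)
  then show ?thesis
    using assms by (intro L3.represented_vanishing) auto
qed

theorem theorem6:
  shows "(Id_star_A :: 'k::field_char_0 free_alg set) = T_star_ideal hull generators"
proof
  show "(Id_star_A :: 'k free_alg set) \<subseteq> gen_ideal"
    by (blast intro: layer1 layer2 layer3 entry_Id_star_A)
qed (rule gen_ideal_subset_Id_star_A)

end
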